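(* Let $\Omega=(B,\mathbf x,R,\mathbf Z)$ be a seed of rank $n$, with $B=(b_{ij})$ and $R=\mathrm{diag}(r_1,\dots,r_n)$. (i) Suppose $\sigma\mu_i,\tau\mu_j\in\mathcal S(\Omega)$ with $i\ne j$, and there exists a Laurent polynomial $F(\mathbf x)\in\mathbb Q[\mathbf x^{\pm}]^{\langle\sigma\mu_i,\tau\mu_j\rangle}$ of type $\frac{\bm\eta}{\mathbf d}$. If $\eta_i\ne0$, then $$4\ge r_ir_j\max\{|b_{ji}|,|b_{\sigma(j)i}|\}\max\{|b_{ij}|,|b_{\tau(i)j}|,|b_{\sigma^{-1}(i)j}|,|b_{\tau(\sigma^{-1}(i))j}|\}.$$ (ii) Suppose $\{\mu_i\mid i\in[1,n]\}\subset\mathcal S(\Omega)$, and let $\mathcal I$ be the set of all indices $i\in[1,n]$ for which there is $j\in[1,n]$ with $j\ne i$ and $r_ir_j|b_{ij}b_{ji}|>4$. If $\#\mathcal I=n$, then $\mathbb Q[\mathbf x^{\pm}]^{\langle\mu_i\mid i\in[1,n]\rangle}=\mathbb Q$. If $\#\mathcal I=n-1$, let $s$ be the unique element of $[1,n]\setminus\mathcal I$. Then $$\mathbb Q[\mathbf x^{\pm}]^{\langle\mu_i\mid i\in[1,n]\rangle}=\begin{cases}\mathbb Q\Big[\dfrac{Z_s(1)+x_s^2}{x_s}\Big],&\text{if } b_{ks}=0\text{ for all }k\in[1,n],\\ \mathbb Q,&\text{otherwise.}\end{cases}$$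
   Context: A seed of rank $n$ is $\Omega=(B,\mathbf x,R,\mathbf Z)$: $B=(b_{ij})$ an $n\times n$ skew-symmetrizable integer matrix; $\mathbf x=(x_1,\dots,x_n)$ a tuple of free generators of $\mathbb Q(x_1,\dots,x_n)$ (the cluster); $R=\mathrm{diag}(r_1,\dots,r_n)$ with positive integers; $\mathbf Z=(Z_1,\dots,Z_n)$ with $Z_k(u)=\sum_{i=0}^{r_k}z_{k,i}u^i\in\mathbb Z_{\ge0}[u]$, $z_{k,i}=z_{k,r_k-i}$, $z_{k,0}=z_{k,r_k}=1$. With $B_s=(b_{1s},\dots,b_{ns})$ and $[\cdot]_+=\max\{\cdot,0\}$ componentwise, $P_{\Omega,s}(\mathbf x)=\sum_{i=0}^{r_s}z_{s,i}\mathbf x^{i[B_s]_++(r_s-i)[-B_s]_+}$. The mutation is $\mu_s(B,\mathbf x,R,\mathbf Z)=(B',\mathbf x',R,\mathbf Z)$ with $b'_{ij}=-b_{ij}$ if $i=s$ or $j=s$, $b'_{ij}=b_{ij}+r_s([b_{is}]_+b_{sj}+b_{is}[-b_{sj}]_+)$ otherwise, $x'_s=P_{\Omega,s}(\mathbf x)/x_s$, $x'_j=x_j$ for $j\neq s$. A permutation $\sigma\in\mathfrak S_n$ acts by $\sigma(B,\mathbf x,R,\mathbf Z)=((b_{\sigma(i)\sigma(j)}),(x_{\sigma(i)}),\mathrm{diag}(r_{\sigma(i)}),(Z_{\sigma(i)}))$; $\sigma\mu_s$ means first $\mu_s$, then $\sigma$. $\mathcal S(\Omega)=\{\sigma\mu_s\mid\sigma\mu_s(B,\mathbf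 x,R,\mathbf Z)=(\pm B,\mathbf x',R,\mathbf Z)\text{ for some }\mathbf x'\}$; its elements are regarded as transformations of clusters. $\mathbb Q[\mathbf x^{\pm}]^{G}=\{F\in\mathbb Q[\mathbf x^{\pm}]\mid F(g(\mathbf x))=F(\mathbf x)\ \forall g\in G\}$. $F$ is of type $\frac{\bm\eta}{\mathbf d}$ if $F=T(\mathbf x)/\mathbf x^{\mathbf d}$ with $T\in\mathbb Q[\mathbf x]$, $\mathbf d\in\mathbb Z^n$, $x_i\nmid T$ for all $i$, and $\eta_i$ is the degree of $T$ in $x_i$. *)

theory Defs
  imports
    "HOL-Computational_Algebra.Polynomial"
    "HOL-Library.Poly_Mapping"
    "HOL-Library.Cardinality"
    "HOL-Algebra.Bij"
    "HOL-Algebra.Generated_Groups"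
begin

text \<open>
  The index set \<open>[1,n]\<close> is a finite type \<open>'n\<close>, so that the rank is \<open>CARD('n)\<close>.
  Polynomials and Laurent polynomials over the rationals are finitely supported coefficient
  functions on exponent vectors; multiplication is the convolution product of
  \<open>Poly_Mapping\<close>.
\<close>

type_synonym 'n mpol = "('n \<Rightarrow>\<^sub>0 nat) \<Rightarrow>\<^sub>0 rat"
type_synonym 'n laurent = "('n \<Rightarrow>\<^sub>0 int) \<Rightarrow>\<^sub>0 rat"

definition mpol_var :: "'n \<Rightarrow> 'n mpol" where
  "mpol_var i = Poly_Mapping.single (Poly_Mapping.single i 1) 1"

definition mpol_degree :: "'n \<Rightarrow> 'n mpol \<Rightarrow> nat" where
  "mpol_degree i T = Max ((\<lambda>m. Poly_Mapping.lookup m i) ` Poly_Mapping.keys T)"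

definition mpol_eval :: "'n::finite mpol \<Rightarrow> ('n \<Rightarrow> 'k::field_char_0) \<Rightarrow> 'k" where
  "mpol_eval T y = (\<Sum>m\<in>Poly_Mapping.keys T.
     of_rat (Poly_Mapping.lookup T m) * (\<Prod>i\<in>UNIV. y i ^ Poly_Mapping.lookup m i))"

definition laurent_const :: "rat \<Rightarrow> 'n laurent" where
  "laurent_const c = Poly_Mapping.single 0 c"

definition laurent_monom :: "('n \<Rightarrow>\<^sub>0 int) \<Rightarrow> 'n laurent" where
  "laurent_monom d = Poly_Mapping.single d 1"

definition laurent_var :: "'n \<Rightarrow> 'n laurent" where
  "laurent_var i = laurent_monom (Poly_Mapping.single i 1)"

definition laurent_of_mpol :: "'n mpol \<Rightarrow> 'n laurent" where
  "laurent_of_mpol T = (\<Sum>m\<in>Poly_Mapping.keys T.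
     Poly_Mapping.single (Poly_Mapping.map int m) (Poly_Mapping.lookup T m))"

definition laurent_eval :: "'n::finite laurent \<Rightarrow> ('n \<Rightarrow> 'k::field_char_0) \<Rightarrow> 'k" where
  "laurent_eval F y = (\<Sum>m\<in>Poly_Mapping.keys F.
     of_rat (Poly_Mapping.lookup F m) * (\<Prod>i\<in>UNIV. y i powi Poly_Mapping.lookup m i))"

definition has_type :: "'n laurent \<Rightarrow> ('n \<Rightarrow> nat) \<Rightarrow> ('n \<Rightarrow>\<^sub>0 int) \<Rightarrow> bool" where
  "has_type F \<eta> d \<longleftrightarrow> (\<exists>T. F = laurent_of_mpol T * laurent_monom (- d)
     \<and> (\<forall>i. \<not> mpol_var i dvd T) \<and> (\<forall>i. \<eta> i = mpol_degree i T))"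

text \<open>The subalgebra generated by the Laurent polynomial \<open>f\<close> over the rationals.\<close>

definition generated_algebra :: "'n laurent \<Rightarrow> 'n laurent set" where
  "generated_algebra f = range (\<lambda>p :: rat poly. poly (map_poly laurent_const p) f)"


text \<open>
  The ambient field is any field \<open>'k\<close> of characteristic zero. A tuple of free generators is
  algebraically independent over the rationals and generates \<open>'k\<close> as a field; its existence
  makes \<open>'k\<close> a rational function field in \<open>CARD('n)\<close> variables.
\<close>

definition free_generators :: "('n::finite \<Rightarrow> 'k::field_char_0) \<Rightarrow> bool" where
  "free_generators y \<longleftrightarrow>
     (\<forall>T. mpol_eval T y = 0 \<longrightarrow> T = 0) \<and>
     (\<forall>a. \<exists>S T. mpol_eval T y \<noteq> 0 \<and> a = mpol_eval S y / mpol_eval T y)"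

text \<open>
  The matrix \<open>R\<close> is given by its diagonal \<open>mdeg\<close>.
\<close>

record ('n, 'k) seed =
  exmat :: "'n \<Rightarrow> 'n \<Rightarrow> int"
  clust :: "'n \<Rightarrow> 'k"
  mdeg :: "'n \<Rightarrow> nat"
  expol :: "'n \<Rightarrow> nat poly"

definition skew_symmetrizable :: "('n \<Rightarrow> 'n \<Rightarrow> int) \<Rightarrow> bool" where
  "skew_symmetrizable B \<longleftrightarrow>
     (\<exists>\<delta> :: 'n \<Rightarrow> int. (\<forall>i. \<delta> i > 0) \<and> (\<forall>i j. \<delta> i * B i j = - (\<delta> j * B j i)))"

definition is_seed :: "('n::finite, 'k::field_char_0) seed \<Rightarrow> bool" where
  "is_seed \<Omega> \<longleftrightarrow>
     skew_symmetrizable (exmat \<Omega>) \<and> free_generators (clust \<Omega>) \<and>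
     (\<forall>k. mdeg \<Omega> k > 0 \<and> degree (expol \<Omega> k) = mdeg \<Omega> k \<and>
        coeff (expol \<Omega> k) 0 = 1 \<and> coeff (expol \<Omega> k) (mdeg \<Omega> k) = 1 \<and>
        (\<forall>i\<le>mdeg \<Omega> k. coeff (expol \<Omega> k) i = coeff (expol \<Omega> k) (mdeg \<Omega> k - i)))"

definition pos_part :: "int \<Rightarrow> int" where
  "pos_part a = max a 0"

definition exchange_value :: "('n::finite, 'k::field_char_0) seed \<Rightarrow> 'n \<Rightarrow> 'k" where
  "exchange_value \<Omega> s = (\<Sum>i\<le>mdeg \<Omega> s. of_nat (coeff (expol \<Omega> s) i) *
     (\<Prod>k\<in>UNIV. clust \<Omega> k powi
        (int i * pos_part (exmat \<Omega> k s) + int (mdeg \<Omega> s - i) * pos_part (- exmat \<Omega> k s))))"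

definition mutate :: "'n \<Rightarrow> ('n::finite, 'k::field_char_0) seed \<Rightarrow> ('n, 'k) seed" where
  "mutate s \<Omega> = \<Omega>\<lparr>
     exmat := (\<lambda>i j. if i = s \<or> j = s then - exmat \<Omega> i j
       else exmat \<Omega> i j + int (mdeg \<Omega> s) *
         (pos_part (exmat \<Omega> i s) * exmat \<Omega> s j + exmat \<Omega> i s * pos_part (- exmat \<Omega> s j))),
     clust := (clust \<Omega>)(s := exchange_value \<Omega> s / clust \<Omega> s)\<rparr>"

definition permute_seed :: "('n \<Rightarrow> 'n) \<Rightarrow> ('n, 'k) seed \<Rightarrow> ('n, 'k) seed" where
  "permute_seed \<sigma> \<Omega> = \<lparr>
     exmat = (\<lambda>i j. exmat \<Omega> (\<sigma> i) (\<sigma> j)),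
     clust = (\<lambda>i. clust \<Omega> (\<sigma> i)),
     mdeg = (\<lambda>i. mdeg \<Omega> (\<sigma> i)),
     expol = (\<lambda>i. expol \<Omega> (\<sigma> i))\<rparr>"

text \<open>The pair \<open>(\<sigma>, s)\<close> stands for \<open>\<sigma>\<mu>\<^sub>s\<close>.\<close>

definition sym_mutations :: "('n::finite, 'k::field_char_0) seed \<Rightarrow> (('n \<Rightarrow> 'n) \<times> 'n) set" where
  "sym_mutations \<Omega> = {(\<sigma>, s). bij \<sigma> \<and>
     (let \<Omega>' = permute_seed \<sigma> (mutate s \<Omega>) in
        (exmat \<Omega>' = exmat \<Omega> \<or> exmat \<Omega>' = (\<lambda>i j. - exmat \<Omega> i j)) \<and>
        mdeg \<Omega>' = mdeg \<Omega> \<and> expol \<Omega>' = expol \<Omega>)}"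

definition clusters :: "('n::finite \<Rightarrow> 'k::field_char_0) set" where
  "clusters = {y. free_generators y}"

text \<open>
  \<open>\<sigma>\<mu>\<^sub>s\<close> as a transformation of clusters, with \<open>B\<close>, \<open>R\<close> and \<open>Z\<close>
  fixed. Replacing \<open>B\<close> by \<open>-B\<close> does not change it, because the \<open>Z\<^sub>k\<close> are
  palindromic; hence for elements of \<open>sym_mutations\<close> composing these maps agrees with
  mutating seeds successively.
  The restriction makes the map extensional, as the carrier of \<open>BijGroup\<close> requires.
\<close>

definition cluster_map ::
  "('n::finite, 'k::field_char_0) seed \<Rightarrow> ('n \<Rightarrow> 'n) \<times> 'n \<Rightarrow> ('n \<Rightarrow> 'k) \<Rightarrow> ('n \<Rightarrow> 'k)" where
  "cluster_map \<Omega> g = restrict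
     (\<lambda>y. clust (permute_seed (fst g) (mutate (snd g) (\<Omega>\<lparr>clust := y\<rparr>)))) clusters"

definition generated_group ::
  "('n::finite, 'k::field_char_0) seed \<Rightarrow> (('n \<Rightarrow> 'n) \<times> 'n) set \<Rightarrow> (('n \<Rightarrow> 'k) \<Rightarrow> ('n \<Rightarrow> 'k)) set" where
  "generated_group \<Omega> A = generate (BijGroup clusters) (cluster_map \<Omega> ` A)"

definition invariants ::
  "('n::finite, 'k::field_char_0) seed \<Rightarrow> (('n \<Rightarrow> 'k) \<Rightarrow> ('n \<Rightarrow> 'k)) set \<Rightarrow> 'n laurent set" where
  "invariants \<Omega> G = {F. \<forall>g\<in>G. laurent_eval F (g (clust \<Omega>)) = laurent_eval F (clust \<Omega>)}"

definition large_indices :: "('n, 'k) seed \<Rightarrow> 'n set" where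
  "large_indices \<Omega> = {i. \<exists>j. j \<noteq> i \<and>
     int (mdeg \<Omega> i) * int (mdeg \<Omega> j) * \<bar>exmat \<Omega> i j * exmat \<Omega> j i\<bar> > 4}"

end

theory Submission
  imports Defs
begin

text \<open>
  The invariance of a Laurent polynomial \<open>F\<close> under \<open>\<sigma>\<mu>\<^sub>i\<close> is an identity of rational
  functions, so it persists at all positive real points. There the orders of growth of both sides
  along \<open>y = t\<^sup>v \<rho>\<close> for \<open>t \<rightarrow> \<infinity>\<close> agree, which makes the support function of the
  Newton polytope of \<open>F\<close> invariant under the tropicalization of \<open>\<sigma>\<mu>\<^sub>i\<close>. Evaluating at
  \<open>v = \<plusminus>e\<^sub>j\<close> shows that the range of exponents of \<open>x\<^sub>i\<close> is symmetric, \<open>[- d\<^sub>i, d\<^sub>i]\<close>,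
  and, by subadditivity, that the range of exponents of every other variable \<open>x\<^sub>j\<close> has length at
  least \<open>r\<^sub>i |b\<^sub>j\<^sub>i| d\<^sub>i\<close>. Playing two mutations against each other gives the bound of part (i).
  In part (ii) the bound forces the variables with large indices not to occur in \<open>F\<close>; if the
  remaining variable \<open>x\<^sub>s\<close> is isolated, then \<open>F\<close> is the average of \<open>F\<close> and its image
  under \<open>x\<^sub>s \<mapsto> Z\<^sub>s(1) / x\<^sub>s\<close>.
\<close>

section \<open>Evaluation and transfer to positive real points\<close>

text \<open>Common form of both evaluations: a function on exponents is extended linearly. Taking
  \<open>mpol_char y\<close> or \<open>laurent_char y\<close> for \<chi> gives the two cases, so
  linearity and multiplicativity are proved once.\<close>

definition lin_ext :: "('m \<Rightarrow> 'k::field_char_0) \<Rightarrow> ('m \<Rightarrow>\<^sub>0 rat) \<Rightarrow> 'k" where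
  "lin_ext \<chi> F = (\<Sum>m\<in>Poly_Mapping.keys F. of_rat (Poly_Mapping.lookup F m) * \<chi> m)"

lemma lin_ext_superset:
  assumes "finite A" "Poly_Mapping.keys F \<subseteq> A"
  shows "lin_ext \<chi> F = (\<Sum>m\<in>A. of_rat (Poly_Mapping.lookup F m) * \<chi> m)"
  unfolding lin_ext_def
  by (rule sum.mono_neutral_left) (use assms in \<open>auto simp: in_keys_iff\<close>)

lemma lin_ext_0 [simp]: "lin_ext \<chi> 0 = 0"
  by (simp add: lin_ext_def)

lemma lin_ext_single [simp]: "lin_ext \<chi> (Poly_Mapping.single m c) = of_rat c * \<chi> m"
  by (cases "c = 0") (simp_all add: lin_ext_def)

lemma lin_ext_add [simp]: "lin_ext \<chi> (F + G) = lin_ext \<chi> F + lin_ext \<chi> G"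
proof -
  let ?A = "Poly_Mapping.keys F \<union> Poly_Mapping.keys G"
  have "lin_ext \<chi> (F + G) = (\<Sum>m\<in>?A. of_rat (Poly_Mapping.lookup (F + G) m) * \<chi> m)"
    by (rule lin_ext_superset) (use keys_add[of F G] in auto)
  moreover have "lin_ext \<chi> F = (\<Sum>m\<in>?A. of_rat (Poly_Mapping.lookup F m) * \<chi> m)"
    and "lin_ext \<chi> G = (\<Sum>m\<in>?A. of_rat (Poly_Mapping.lookup G m) * \<chi> m)"
    by (rule lin_ext_superset; simp)+
  ultimately show ?thesis
    by (simp add: lookup_add of_rat_add algebra_simps sum.distrib)
qed

lemma lin_ext_diff [simp]: "lin_ext \<chi> (F - G) = lin_ext \<chi> F - lin_ext \<chi> G"
  using lin_ext_add[of \<chi> "F - G" G] by simp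

lemma lin_ext_sum [simp]: "lin_ext \<chi> (sum f A) = (\<Sum>a\<in>A. lin_ext \<chi> (f a))"
  by (induction A rule: infinite_finite_induct) auto

lemma poly_mapping_sum_single:
  "(\<Sum>m\<in>Poly_Mapping.keys F. Poly_Mapping.single m (Poly_Mapping.lookup F m)) = F"
proof (rule poly_mapping_eqI)
  fix k
  have "(\<Sum>m\<in>Poly_Mapping.keys F. Poly_Mapping.lookup F m when m = k) = Poly_Mapping.lookup F k"
    by (cases "k \<in> Poly_Mapping.keys F")
      (auto simp: when_def in_keys_iff if_distrib sum.delta cong: if_cong)
  then show "Poly_Mapping.lookup (\<Sum>m\<in>Poly_Mapping.keys F. Poly_Mapping.single m (Poly_Mapping.lookup F m)) k
      = Poly_Mapping.lookup F k"
    by (simp add: lookup_sum lookup_single)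
qed

text \<open>Both factors are expanded into single terms; on these the convolution product adds
  exponents, where \<chi> is multiplicative.\<close>

lemma lin_ext_mult:
  fixes F G :: "'m::monoid_add \<Rightarrow>\<^sub>0 rat"
  assumes "\<And>m m'. \<chi> (m + m') = \<chi> m * \<chi> m'"
  shows "lin_ext \<chi> (F * G) = lin_ext \<chi> F * lin_ext \<chi> G"
proof -
  let ?s = "\<lambda>F m. Poly_Mapping.single m (Poly_Mapping.lookup F m)"
  have "F * G = (\<Sum>m\<in>Poly_Mapping.keys F. ?s F m) * (\<Sum>m\<in>Poly_Mapping.keys G. ?s G m)"
    by (simp only: poly_mapping_sum_single)
  also have "\<dots> = (\<Sum>m\<in>Poly_Mapping.keys F. \<Sum>m'\<in>Poly_Mapping.keys G. ?s F m * ?s G m')"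
    by (simp add: sum_product)
  finally show ?thesis
    by (simp add: lin_ext_def[of \<chi> F] lin_ext_def[of \<chi> G] mult_single sum_product assms of_rat_mult algebra_simps)
qed

definition mpol_char :: "('n::finite \<Rightarrow> 'k::field_char_0) \<Rightarrow> ('n \<Rightarrow>\<^sub>0 nat) \<Rightarrow> 'k" where
  "mpol_char y m = (\<Prod>i\<in>UNIV. y i ^ Poly_Mapping.lookup m i)"

definition laurent_char :: "('n::finite \<Rightarrow> 'k::field_char_0) \<Rightarrow> ('n \<Rightarrow>\<^sub>0 int) \<Rightarrow> 'k" where
  "laurent_char y m = (\<Prod>i\<in>UNIV. y i powi Poly_Mapping.lookup m i)"

lemma mpol_eval_lin_ext: "mpol_eval T y = lin_ext (mpol_char y) T"
  by (simp add: mpol_eval_def lin_ext_def mpol_char_def)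

lemma laurent_eval_lin_ext: "laurent_eval F y = lin_ext (laurent_char y) F"
  by (simp add: laurent_eval_def lin_ext_def laurent_char_def)

lemma mpol_char_0 [simp]: "mpol_char y 0 = 1"
  by (simp add: mpol_char_def)

lemma laurent_char_0 [simp]: "laurent_char y 0 = 1"
  by (simp add: laurent_char_def)

lemma mpol_char_add: "mpol_char y (m + m') = mpol_char y m * mpol_char y m'"
  by (simp add: mpol_char_def lookup_add power_add prod.distrib)

lemma laurent_char_add:
  assumes "\<And>i. y i \<noteq> 0"
  shows "laurent_char y (m + m') = laurent_char y m * laurent_char y m'"
  using assms by (simp add: laurent_char_def lookup_add power_int_add prod.distrib)

text \<open>Stated for a general \<open>f\<close> so as to cover natural powers and integer powers
  alike.\<close>

lemma prod_single_exponent: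
  fixes f :: "'n::finite \<Rightarrow> 'b::zero \<Rightarrow> 'k::comm_monoid_mult"
  assumes "\<And>j. f j 0 = 1"
  shows "(\<Prod>j\<in>UNIV. f j (Poly_Mapping.lookup (Poly_Mapping.single i e) j)) = f i e"
proof -
  have "(\<Prod>j\<in>UNIV. f j (Poly_Mapping.lookup (Poly_Mapping.single i e) j))
      = (\<Prod>j\<in>UNIV. if j = i then f i e else 1)"
    by (rule prod.cong) (auto simp: lookup_single when_def assms)
  then show ?thesis by simp
qed

lemma mpol_char_single [simp]: "mpol_char y (Poly_Mapping.single i e) = y i ^ e"
  using prod_single_exponent[of "\<lambda>j e. y j ^ e" i e] by (simp add: mpol_char_def)

lemma laurent_char_single [simp]: "laurent_char y (Poly_Mapping.single i e) = y i powi e"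
  using prod_single_exponent[of "\<lambda>j e. y j powi e" i e] by (simp add: laurent_char_def)

lemma mpol_eval_add: "mpol_eval (S + T) y = mpol_eval S y + mpol_eval T y"
  by (simp add: mpol_eval_lin_ext)

lemma mpol_eval_mult: "mpol_eval (S * T) y = mpol_eval S y * mpol_eval T y"
  by (simp add: mpol_eval_lin_ext lin_ext_mult mpol_char_add)

lemma mpol_eval_const: "mpol_eval (Poly_Mapping.single 0 c) y = of_rat c"
  by (simp add: mpol_eval_lin_ext)

lemma mpol_eval_1 [simp]: "mpol_eval 1 y = 1"
  using mpol_eval_const[of 1 y] by simp

lemma mpol_eval_var: "mpol_eval (mpol_var i) y = y i"
  by (simp add: mpol_eval_lin_ext mpol_var_def)

lemma laurent_eval_add: "laurent_eval (F + G) y = laurent_eval F y + laurent_eval G y"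
  by (simp add: laurent_eval_lin_ext)

lemma laurent_eval_diff: "laurent_eval (F - G) y = laurent_eval F y - laurent_eval G y"
  by (simp add: laurent_eval_lin_ext)

lemma laurent_eval_mult:
  "(\<And>i. y i \<noteq> 0) \<Longrightarrow> laurent_eval (F * G) y = laurent_eval F y * laurent_eval G y"
  by (simp add: laurent_eval_lin_ext lin_ext_mult laurent_char_add)

lemma laurent_eval_const [simp]: "laurent_eval (laurent_const c) y = of_rat c"
  by (simp add: laurent_eval_lin_ext laurent_const_def)

text \<open>The monomials are distinct characters of the group of positive vectors, hence linearly
  independent: multiplying the \<open>i\<close>-th coordinate by \<open>2\<close> allows one to eliminate a
  monomial.\<close>

lemma positive_characters_independent:
  fixes c :: "('n::finite \<Rightarrow> int) \<Rightarrow> real"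
  assumes "finite K"
    and "\<And>y :: 'n \<Rightarrow> real. (\<And>i. 0 < y i) \<Longrightarrow> (\<Sum>m\<in>K. c m * (\<Prod>i\<in>UNIV. y i powi m i)) = 0"
    and "m \<in> K"
  shows "c m = 0"
  using assms
proof (induction K arbitrary: c m rule: finite_induct)
  case empty
  then show ?case by simp
next
  case (insert m0 K)
  have tail: "c m' = 0" if m': "m' \<in> K" for m'
  proof -
    have "m' \<noteq> m0" using insert.hyps m' by auto
    then obtain i where i: "m' i \<noteq> m0 i" by blast
    \<comment> \<open>These are the coefficients of the relation at \<open>?y\<close> minus
      \<open>2 powi m0 i\<close> times the relation at \<open>y\<close>; the one of
      \<open>m0\<close> vanishes, so the induction hypothesis applies to \<open>K\<close>.\<close>
    have "c m' * (2 powi m' i - 2 powi m0 i) = 0"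
    proof (rule insert.IH[OF _ m'])
      fix y :: "'n \<Rightarrow> real" assume y: "\<And>i. 0 < y i"
      let ?M = "\<lambda>y m. \<Prod>i\<in>UNIV. (y i :: real) powi m i"
      let ?y = "y(i := 2 * y i)"
      have scale: "?M ?y m = 2 powi m i * ?M y m" for m
      proof -
        have "?M ?y m = ?y i powi m i * (\<Prod>j\<in>UNIV - {i}. ?y j powi m j)"
          by (rule prod.remove) auto
        also have "(\<Prod>j\<in>UNIV - {i}. ?y j powi m j) = (\<Prod>j\<in>UNIV - {i}. y j powi m j)"
          by (rule prod.cong) auto
        also have "?y i powi m i * \<dots> = 2 powi m i * (y i powi m i * \<dots>)"
          by (simp add: power_int_mult_distrib)
        also have "y i powi m i * (\<Prod>j\<in>UNIV - {i}. y j powi m j) = ?M y m"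
          by (rule prod.remove[symmetric]) auto
        finally show ?thesis .
      qed
      have "(\<Sum>m\<in>insert m0 K. c m * ?M ?y m) = 0" "(\<Sum>m\<in>insert m0 K. c m * ?M y m) = 0"
        by (rule insert.prems(1); use y in \<open>simp add: less_imp_le\<close>)+
      then have "(\<Sum>m\<in>insert m0 K. c m * ?M ?y m)
          - 2 powi m0 i * (\<Sum>m\<in>insert m0 K. c m * ?M y m) = 0" by simp
      then have "(\<Sum>m\<in>insert m0 K. c m * (2 powi m i - 2 powi m0 i) * ?M y m) = 0"
        unfolding scale by (simp add: sum_distrib_left sum_subtractf[symmetric] algebra_simps)
      then show "(\<Sum>m\<in>K. c m * (2 powi m i - 2 powi m0 i) * ?M y m) = 0"
        using insert.hyps by simp
    qed
    moreover have "(2::real) powi m' i \<noteq> 2 powi m0 i"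
      using i power_int_strict_increasing[of "m' i" "m0 i" "2::real"]
        power_int_strict_increasing[of "m0 i" "m' i" "2::real"] by (cases "m' i < m0 i") auto
    ultimately show ?thesis by simp
  qed
  show ?case
  proof (cases "m = m0")
    case True
    \<comment> \<open>With all other coefficients zero, evaluation at the all-ones point leaves
      \<open>c m0\<close>.\<close>
    have "(\<Sum>m\<in>insert m0 K. c m * (\<Prod>i\<in>UNIV. (1::real) powi m i)) = 0"
      by (rule insert.prems(1)) simp
    with insert.hyps True tail show ?thesis by simp
  next
    case False
    with insert.prems tail show ?thesis by auto
  qed
qed

text \<open>The injection \<open>e\<close> turns either kind of exponent vector into an integer
  function, to which the independence of characters applies.\<close>

lemma lin_ext_positive_eq_0:
  fixes F :: "'m \<Rightarrow>\<^sub>0 rat" and e :: "'m \<Rightarrow> 'n::finite \<Rightarrow> int"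
  assumes inj: "inj e"
    and zero: "\<And>y :: 'n \<Rightarrow> real. (\<And>i. 0 < y i) \<Longrightarrow> lin_ext (\<lambda>m. \<Prod>i\<in>UNIV. y i powi e m i) F = 0"
  shows "F = 0"
proof (rule poly_mapping_eqI)
  fix m
  let ?c = "\<lambda>a. real_of_rat (Poly_Mapping.lookup F (inv_into UNIV e a))"
  show "Poly_Mapping.lookup F m = Poly_Mapping.lookup 0 m"
  proof (cases "m \<in> Poly_Mapping.keys F")
    case True
    have "?c (e m) = 0"
    proof (rule positive_characters_independent[of "e ` Poly_Mapping.keys F"])
      fix y :: "'n \<Rightarrow> real" assume "\<And>i. 0 < y i"
      from zero[of y, OF this] show "(\<Sum>a\<in>e ` Poly_Mapping.keys F. ?c a * (\<Prod>i\<in>UNIV. y i powi a i)) = 0"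
        by (subst sum.reindex) (auto simp: lin_ext_def inv_f_f[OF inj] intro: inj_on_subset[OF inj])
    qed (use True in auto)
    then show ?thesis by (simp add: inv_f_f[OF inj])
  qed (simp add: in_keys_iff)
qed

text \<open>Later identities between Laurent polynomials are checked through this lemma: at positive
  points every coordinate is invertible.\<close>

lemma laurent_eqI_positive:
  fixes F G :: "'n::finite laurent"
  assumes "\<And>y :: 'n \<Rightarrow> real. (\<And>i. 0 < y i) \<Longrightarrow> laurent_eval F y = laurent_eval G y"
  shows "F = G"
proof -
  have "inj (Poly_Mapping.lookup :: ('n \<Rightarrow>\<^sub>0 int) \<Rightarrow> _)"
    by (auto intro!: injI poly_mapping_eqI)
  then have "F - G = 0"
    by (rule lin_ext_positive_eq_0) (use assms in \<open>simp add: laurent_eval_lin_ext laurent_char_def[abs_def]\<close>)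
  then show ?thesis by simp
qed

lemma mpol_eq_0I_positive:
  fixes T :: "'n::finite mpol"
  assumes "\<And>y :: 'n \<Rightarrow> real. (\<And>i. 0 < y i) \<Longrightarrow> mpol_eval T y = 0"
  shows "T = 0"
proof (rule lin_ext_positive_eq_0[of "\<lambda>m i. int (Poly_Mapping.lookup m i)"])
  show "inj (\<lambda>(m :: 'n \<Rightarrow>\<^sub>0 nat) i. int (Poly_Mapping.lookup m i))"
    by (auto intro!: injI poly_mapping_eqI simp: fun_eq_iff)
qed (use assms in \<open>simp add: mpol_eval_lin_ext mpol_char_def[abs_def]\<close>)

text \<open>The graph of the partial homomorphism from one field to another that sends the point
  \<open>x\<close> to the point \<open>y\<close>.\<close>

definition corresponds ::
  "('n::finite \<Rightarrow> 'k::field_char_0) \<Rightarrow> ('n \<Rightarrow> 'l::field_char_0) \<Rightarrow> 'k \<Rightarrow> 'l \<Rightarrow> bool" where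
  "corresponds x y a b \<longleftrightarrow> (\<exists>S T. mpol_eval T x \<noteq> 0 \<and> mpol_eval T y \<noteq> 0 \<and>
     a = mpol_eval S x / mpol_eval T x \<and> b = mpol_eval S y / mpol_eval T y)"

lemma corresponds_mpol: "corresponds x y (mpol_eval S x) (mpol_eval S y)"
  unfolding corresponds_def by (rule exI[of _ S], rule exI[of _ 1]) simp

lemma corresponds_of_rat: "corresponds x y (of_rat c) (of_rat c)"
  using corresponds_mpol[of x y "Poly_Mapping.single 0 c"] by (simp add: mpol_eval_const)

lemma corresponds_1: "corresponds x y 1 1"
  using corresponds_of_rat[of x y 1] by simp

lemma corresponds_0: "corresponds x y 0 0"
  using corresponds_of_rat[of x y 0] by simp

lemma corresponds_of_nat: "corresponds x y (of_nat c) (of_nat c)"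
  using corresponds_of_rat[of x y "of_nat c"] by simp

lemma corresponds_var: "corresponds x y (x i) (y i)"
  using corresponds_mpol[of x y "mpol_var i"] by (simp add: mpol_eval_var)

lemma corresponds_add:
  assumes "corresponds x y a b" "corresponds x y a' b'"
  shows "corresponds x y (a + a') (b + b')"
proof -
  from assms obtain S T S' T' where
    "mpol_eval T x \<noteq> 0" "mpol_eval T y \<noteq> 0"
    "a = mpol_eval S x / mpol_eval T x" "b = mpol_eval S y / mpol_eval T y"
    "mpol_eval T' x \<noteq> 0" "mpol_eval T' y \<noteq> 0"
    "a' = mpol_eval S' x / mpol_eval T' x" "b' = mpol_eval S' y / mpol_eval T' y"
    unfolding corresponds_def by blast
  then show ?thesis
    unfolding corresponds_def
    by - (rule exI[of _ "S * T' + S' * T"], rule exI[of _ "T * T'"], simp add: mpol_eval_add mpol_eval_mult add_frac_eq)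
qed

lemma corresponds_mult:
  assumes "corresponds x y a b" "corresponds x y a' b'"
  shows "corresponds x y (a * a') (b * b')"
proof -
  from assms obtain S T S' T' where
    "mpol_eval T x \<noteq> 0" "mpol_eval T y \<noteq> 0"
    "a = mpol_eval S x / mpol_eval T x" "b = mpol_eval S y / mpol_eval T y"
    "mpol_eval T' x \<noteq> 0" "mpol_eval T' y \<noteq> 0"
    "a' = mpol_eval S' x / mpol_eval T' x" "b' = mpol_eval S' y / mpol_eval T' y"
    unfolding corresponds_def by blast
  then show ?thesis
    unfolding corresponds_def
    by - (rule exI[of _ "S * S'"], rule exI[of _ "T * T'"], simp add: mpol_eval_mult)
qed

lemma corresponds_inverse:
  assumes "corresponds x y a b" "a \<noteq> 0" "b \<noteq> 0"
  shows "corresponds x y (inverse a) (inverse b)"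
proof -
  from assms(1) obtain S T where
    "mpol_eval T x \<noteq> 0" "mpol_eval T y \<noteq> 0"
    "a = mpol_eval S x / mpol_eval T x" "b = mpol_eval S y / mpol_eval T y"
    unfolding corresponds_def by blast
  then show ?thesis
    using assms(2,3) unfolding corresponds_def
    by - (rule exI[of _ T], rule exI[of _ S], simp)
qed

lemma corresponds_divide:
  assumes "corresponds x y a b" "corresponds x y a' b'" "a' \<noteq> 0" "b' \<noteq> 0"
  shows "corresponds x y (a / a') (b / b')"
  using corresponds_mult[OF assms(1) corresponds_inverse[OF assms(2-4)]]
  by (simp add: divide_inverse)

lemma corresponds_sum:
  "(\<And>i. i \<in> A \<Longrightarrow> corresponds x y (f i) (g i)) \<Longrightarrow> corresponds x y (sum f A) (sum g A)"
  by (induction A rule: infinite_finite_induct) (auto simp: corresponds_0 corresponds_add)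

lemma corresponds_prod:
  "(\<And>i. i \<in> A \<Longrightarrow> corresponds x y (f i) (g i)) \<Longrightarrow> corresponds x y (prod f A) (prod g A)"
  by (induction A rule: infinite_finite_induct) (auto simp: corresponds_1 corresponds_mult)

lemma corresponds_power:
  "corresponds x y a b \<Longrightarrow> corresponds x y (a ^ n) (b ^ n)"
  by (induction n) (auto simp: corresponds_1 corresponds_mult)

lemma corresponds_powi:
  assumes "corresponds x y a b" "a \<noteq> 0" "b \<noteq> 0"
  shows "corresponds x y (a powi n) (b powi n)"
  using assms corresponds_power[OF assms(1), of "nat n"]
    corresponds_power[OF corresponds_inverse[OF assms], of "nat (- n)"]
  by (cases "n \<ge> 0") (auto simp: power_int_def)

lemma corresponds_mpol_eval:
  assumes "\<And>i. corresponds x y (a i) (b i)"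
  shows "corresponds x y (mpol_eval S a) (mpol_eval S b)"
  unfolding mpol_eval_def
  by (intro corresponds_sum corresponds_mult corresponds_of_rat corresponds_prod corresponds_power assms)

lemma corresponds_laurent_eval:
  assumes "\<And>i. corresponds x y (a i) (b i)" "\<And>i. a i \<noteq> 0" "\<And>i. b i \<noteq> 0"
  shows "corresponds x y (laurent_eval F a) (laurent_eval F b)"
  unfolding laurent_eval_def
  by (intro corresponds_sum corresponds_mult corresponds_of_rat corresponds_prod corresponds_powi assms)

text \<open>If the fraction \<open>S / T\<close> vanishes at the free point \<open>x\<close>, then
  its numerator is the zero polynomial and so vanishes at \<open>y\<close> as well.\<close>

lemma corresponds_zero:
  assumes "free_generators x" "corresponds x y 0 b"
  shows "b = 0"
  using assms unfolding free_generators_def corresponds_def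
  by (auto simp: mpol_eval_lin_ext)

text \<open>The partial homomorphism is single-valued: the difference of two values corresponds to
  zero.\<close>

lemma corresponds_eq:
  assumes "free_generators x" "corresponds x y a b" "corresponds x y a b'"
  shows "b = b'"
proof -
  have "corresponds x y (- a) (- b')"
    using corresponds_mult[OF corresponds_of_rat[of x y "-1"] assms(3)] by simp
  from corresponds_add[OF assms(2) this] have "corresponds x y 0 (b - b')" by simp
  from corresponds_zero[OF assms(1) this] show ?thesis by simp
qed

section \<open>Growth and the support function of the Newton polytope\<close>

text \<open>A bound of order \<open>t powi c\<close> along \<open>y = t powi v * \<rho>\<close>,
  uniform for \<rho> in each compact box of the positive orthant. Uniformity is essential: after a
  mutation the factor \<rho> depends on \<open>t\<close> and merely stays in some other box.\<close>

definition growth_le :: "(('n \<Rightarrow> real) \<Rightarrow> real) \<Rightarrow> ('n \<Rightarrow> int) \<Rightarrow> int \<Rightarrow> bool" where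
  "growth_le f v c \<longleftrightarrow> (\<forall>\<alpha>>0. \<forall>\<beta>. \<exists>C. \<forall>t\<ge>1. \<forall>\<rho>.
     (\<forall>l. \<alpha> \<le> \<rho> l \<and> \<rho> l \<le> \<beta>) \<longrightarrow> \<bar>f (\<lambda>l. t powi v l * \<rho> l)\<bar> \<le> C * t powi c)"

lemma growth_leD:
  assumes "growth_le f v c" "0 < \<alpha>"
  obtains C where "\<And>t \<rho>. 1 \<le> t \<Longrightarrow> (\<And>l. \<alpha> \<le> \<rho> l \<and> \<rho> l \<le> \<beta>) \<Longrightarrow>
     \<bar>f (\<lambda>l. t powi v l * \<rho> l)\<bar> \<le> C * t powi c"
  using assms unfolding growth_le_def by metis

lemma growth_le_cong:
  fixes f :: "('n \<Rightarrow> real) \<Rightarrow> real"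
  assumes growth: "growth_le f v c"
    and eq: "\<And>y. (\<And>l. 0 < y l) \<Longrightarrow> g y = f y"
  shows "growth_le g v c"
  unfolding growth_le_def
proof (intro allI impI)
  fix \<alpha> \<beta> :: real assume \<alpha>: "0 < \<alpha>"
  from growth \<alpha> obtain C where C: "\<And>t \<rho>. 1 \<le> t \<Longrightarrow> (\<And>l. \<alpha> \<le> \<rho> l \<and> \<rho> l \<le> \<beta>) \<Longrightarrow>
      \<bar>f (\<lambda>l. t powi v l * \<rho> l)\<bar> \<le> C * t powi c"
    by (rule growth_leD[where \<beta> = \<beta>]) blast
  show "\<exists>C. \<forall>t\<ge>1. \<forall>\<rho>. (\<forall>l. \<alpha> \<le> \<rho> l \<and> \<rho> l \<le> \<beta>) \<longrightarrow>
      \<bar>g (\<lambda>l. t powi v l * \<rho> l)\<bar> \<le> C * t powi c"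
  proof (intro exI allI impI)
    fix t :: real and \<rho> :: "'n \<Rightarrow> real"
    assume t: "1 \<le> t" and \<rho>: "\<forall>l. \<alpha> \<le> \<rho> l \<and> \<rho> l \<le> \<beta>"
    have "0 < \<rho> l" for l using \<alpha> \<rho> less_le_trans by blast
    then have "g (\<lambda>l. t powi v l * \<rho> l) = f (\<lambda>l. t powi v l * \<rho> l)"
      using t by (intro eq mult_pos_pos) auto
    then show "\<bar>g (\<lambda>l. t powi v l * \<rho> l)\<bar> \<le> C * t powi c"
      using C t \<rho> by simp
  qed
qed

text \<open>A box has the same bounds in every coordinate, so permuting the coordinates of \<rho>
  maps it onto itself.\<close>

lemma growth_le_permute:
  fixes \<sigma> :: "'m \<Rightarrow> 'n"
  assumes "bij \<sigma>"
  shows "growth_le (\<lambda>y. f (\<lambda>m. y (\<sigma> m))) w c \<longleftrightarrow> growth_le f (\<lambda>m. w (\<sigma> m)) c"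
proof
  assume L: "growth_le (\<lambda>y. f (\<lambda>m. y (\<sigma> m))) w c"
  show "growth_le f (\<lambda>m. w (\<sigma> m)) c"
    unfolding growth_le_def
  proof (intro allI impI)
    fix \<alpha> \<beta> :: real assume \<alpha>: "0 < \<alpha>"
    from L \<alpha> obtain C where C: "\<And>t \<rho>. 1 \<le> t \<Longrightarrow> (\<And>l. \<alpha> \<le> \<rho> l \<and> \<rho> l \<le> \<beta>) \<Longrightarrow>
        \<bar>f (\<lambda>m. t powi w (\<sigma> m) * \<rho> (\<sigma> m))\<bar> \<le> C * t powi c"
      by (rule growth_leD[where \<beta> = \<beta>]) blast
    show "\<exists>C. \<forall>t\<ge>1. \<forall>\<rho>. (\<forall>l. \<alpha> \<le> \<rho> l \<and> \<rho> l \<le> \<beta>) \<longrightarrow>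
        \<bar>f (\<lambda>l. t powi w (\<sigma> l) * \<rho> l)\<bar> \<le> C * t powi c"
    proof (intro exI allI impI)
      fix t :: real and \<rho> :: "'m \<Rightarrow> real" assume "1 \<le> t" "\<forall>l. \<alpha> \<le> \<rho> l \<and> \<rho> l \<le> \<beta>"
      with C[of t "\<lambda>l. \<rho> (inv_into UNIV \<sigma> l)"]
      show "\<bar>f (\<lambda>l. t powi w (\<sigma> l) * \<rho> l)\<bar> \<le> C * t powi c"
        using assms by (simp add: bij_is_inj)
    qed
  qed
next
  assume R: "growth_le f (\<lambda>m. w (\<sigma> m)) c"
  show "growth_le (\<lambda>y. f (\<lambda>m. y (\<sigma> m))) w c"
    unfolding growth_le_def
  proof (intro allI impI)
    fix \<alpha> \<beta> :: real assume \<alpha>: "0 < \<alpha>"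
    from R \<alpha> obtain C where C: "\<And>t \<rho>. 1 \<le> t \<Longrightarrow> (\<And>l. \<alpha> \<le> \<rho> l \<and> \<rho> l \<le> \<beta>) \<Longrightarrow>
        \<bar>f (\<lambda>m. t powi w (\<sigma> m) * \<rho> m)\<bar> \<le> C * t powi c"
      by (rule growth_leD[where \<beta> = \<beta>]) blast
    show "\<exists>C. \<forall>t\<ge>1. \<forall>\<rho>. (\<forall>l. \<alpha> \<le> \<rho> l \<and> \<rho> l \<le> \<beta>) \<longrightarrow>
        \<bar>f (\<lambda>m. t powi w (\<sigma> m) * \<rho> (\<sigma> m))\<bar> \<le> C * t powi c"
      using C by (intro exI[of _ C]) simp
  qed
qed

lemma prod_powi_scale:
  fixes t :: real and m v :: "'n::finite \<Rightarrow> int"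
  assumes "0 < t"
  shows "(\<Prod>l\<in>UNIV. (t powi v l * \<rho> l) powi m l)
    = t powi (\<Sum>l\<in>UNIV. v l * m l) * (\<Prod>l\<in>UNIV. \<rho> l powi m l)"
proof -
  have "(\<Prod>l\<in>A. t powi (v l * m l)) = t powi (\<Sum>l\<in>A. v l * m l)" for A
    using assms by (induction A rule: infinite_finite_induct) (auto simp: power_int_add)
  then show ?thesis
    by (simp add: power_int_mult_distrib prod.distrib power_int_mult)
qed

lemma powi_between:
  fixes \<alpha> \<beta> \<rho> :: real
  assumes "0 < \<alpha>" "\<alpha> \<le> \<rho>" "\<rho> \<le> \<beta>"
  shows "\<rho> powi m \<le> max (\<alpha> powi m) (\<beta> powi m)"
proof (cases "0 \<le> m")
  case True
  then have "\<rho> powi m \<le> \<beta> powi m" using assms by (intro power_int_mono) auto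
  then show ?thesis by simp
next
  case False
  then have "\<rho> powi m \<le> \<alpha> powi m" using assms by (intro power_int_antimono) auto
  then show ?thesis by simp
qed

text \<open>The support function of the Newton polytope of \<open>F\<close> in direction
  \<open>v\<close>. It is meaningful for nonzero \<open>F\<close> only, \<open>Max\<close> being
  taken over an empty set otherwise.\<close>

definition height :: "'n::finite laurent \<Rightarrow> ('n \<Rightarrow> int) \<Rightarrow> int" where
  "height F v = Max ((\<lambda>m. \<Sum>l\<in>UNIV. v l * Poly_Mapping.lookup m l) ` Poly_Mapping.keys F)"

lemma height_ge: "m \<in> Poly_Mapping.keys F \<Longrightarrow> (\<Sum>l\<in>UNIV. v l * Poly_Mapping.lookup m l) \<le> height F v"
  unfolding height_def by (rule Max_ge) auto

lemma height_attained:
  assumes "F \<noteq> 0"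
  obtains m where "m \<in> Poly_Mapping.keys F" "height F v = (\<Sum>l\<in>UNIV. v l * Poly_Mapping.lookup m l)"
proof -
  have "height F v \<in> (\<lambda>m. \<Sum>l\<in>UNIV. v l * Poly_Mapping.lookup m l) ` Poly_Mapping.keys F"
    unfolding height_def by (rule Max_in) (use assms in \<open>auto simp: poly_mapping_eq_iff in_keys_iff fun_eq_iff\<close>)
  then show ?thesis using that by blast
qed

lemma laurent_eval_scale:
  fixes t :: real
  assumes "0 < t"
  shows "laurent_eval F (\<lambda>l :: 'n::finite. t powi v l * \<rho> l)
    = (\<Sum>m\<in>Poly_Mapping.keys F. of_rat (Poly_Mapping.lookup F m) *
        (t powi (\<Sum>l\<in>UNIV. v l * Poly_Mapping.lookup m l) * laurent_char \<rho> m))"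
  by (simp add: laurent_eval_def laurent_char_def prod_powi_scale[OF assms])

text \<open>Each monomial contributes a power of \<open>t\<close> of exponent at most the height,
  times a factor bounded on the box.\<close>

lemma growth_le_height:
  fixes F :: "'n::finite laurent"
  shows "growth_le (laurent_eval F) v (height F v)"
  unfolding growth_le_def
proof (intro allI impI)
  fix \<alpha> \<beta> :: real assume \<alpha>: "0 < \<alpha>"
  \<comment> \<open>Exponents may have either sign, so both ends of the interval compete for the
    bound.\<close>
  define K where "K m = (\<Prod>l\<in>UNIV. max (\<alpha> powi Poly_Mapping.lookup m l) (\<beta> powi Poly_Mapping.lookup m l))"
    for m :: "'n \<Rightarrow>\<^sub>0 int"
  define C where "C = (\<Sum>m\<in>Poly_Mapping.keys F. \<bar>real_of_rat (Poly_Mapping.lookup F m)\<bar> * K m)"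
  show "\<exists>C. \<forall>t\<ge>1. \<forall>\<rho>. (\<forall>l. \<alpha> \<le> \<rho> l \<and> \<rho> l \<le> \<beta>) \<longrightarrow>
      \<bar>laurent_eval F (\<lambda>l. t powi v l * \<rho> l)\<bar> \<le> C * t powi height F v"
  proof (intro exI allI impI)
    fix t :: real and \<rho> :: "'n \<Rightarrow> real" assume t: "1 \<le> t" and \<rho>: "\<forall>l. \<alpha> \<le> \<rho> l \<and> \<rho> l \<le> \<beta>"
    have pos: "0 < \<rho> l" for l using \<alpha> \<rho> less_le_trans by blast
    have K: "laurent_char \<rho> m \<le> K m" for m
      unfolding laurent_char_def K_def
      by (rule prod_mono) (use \<alpha> \<rho> pos in \<open>auto intro!: powi_between simp: less_imp_le\<close>)
    have char_pos: "0 \<le> laurent_char \<rho> m" for m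
      unfolding laurent_char_def by (rule prod_nonneg) (use pos in \<open>simp add: less_imp_le\<close>)
    have "\<bar>laurent_eval F (\<lambda>l. t powi v l * \<rho> l)\<bar>
        \<le> (\<Sum>m\<in>Poly_Mapping.keys F. \<bar>of_rat (Poly_Mapping.lookup F m) *
        (t powi (\<Sum>l\<in>UNIV. v l * Poly_Mapping.lookup m l) * laurent_char \<rho> m)\<bar>)"
      using t by (subst laurent_eval_scale) (auto intro: sum_abs)
    also have "\<dots> \<le> (\<Sum>m\<in>Poly_Mapping.keys F. \<bar>of_rat (Poly_Mapping.lookup F m)\<bar> * (t powi height F v * K m))"
    proof (rule sum_mono)
      fix m assume "m \<in> Poly_Mapping.keys F"
      then have "t powi (\<Sum>l\<in>UNIV. v l * Poly_Mapping.lookup m l) \<le> t powi height F v"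
        using t by (intro power_int_increasing height_ge) auto
      then have "t powi (\<Sum>l\<in>UNIV. v l * Poly_Mapping.lookup m l) * laurent_char \<rho> m \<le> t powi height F v * K m"
        using t char_pos K by (intro mult_mono) auto
      moreover have "0 \<le> t powi (\<Sum>l\<in>UNIV. v l * Poly_Mapping.lookup m l) * laurent_char \<rho> m"
        using t char_pos by simp
      ultimately show "\<bar>of_rat (Poly_Mapping.lookup F m) *
        (t powi (\<Sum>l\<in>UNIV. v l * Poly_Mapping.lookup m l) * laurent_char \<rho> m)\<bar>
        \<le> \<bar>of_rat (Poly_Mapping.lookup F m)\<bar> * (t powi height F v * K m)"
        unfolding abs_mult[of "of_rat (Poly_Mapping.lookup F m)"] by (intro mult_left_mono) auto
    qed
    also have "\<dots> = C * t powi height F v"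
      by (simp add: C_def sum_distrib_left sum_distrib_right mult_ac)
    finally show "\<bar>laurent_eval F (\<lambda>l. t powi v l * \<rho> l)\<bar> \<le> C * t powi height F v" .
  qed
qed

lemma tendsto_powi_neg:
  assumes "k < 0"
  shows "(\<lambda>n. real (Suc n) powi k) \<longlonglongrightarrow> 0"
proof -
  have "(\<lambda>n. inverse (real (Suc n)) ^ nat (- k)) \<longlonglongrightarrow> 0 ^ nat (- k)"
    by (intro tendsto_power LIMSEQ_inverse_real_of_nat)
  then show ?thesis using assms by (simp add: power_int_def zero_power)
qed

text \<open>The terms of maximal weight form a nonzero Laurent polynomial, which is nonzero at some
  positive \<open>y\<close>. Divided by \<open>t powi height F v\<close>, the value of
  \<open>F\<close> along the curve through \<open>y\<close> tends to that number, whereas a smaller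
  order of growth would force the limit zero.\<close>

lemma height_le_growth:
  fixes F :: "'n::finite laurent"
  assumes "F \<noteq> 0" and growth: "growth_le (laurent_eval F) v c"
  shows "height F v \<le> c"
proof (rule ccontr)
  assume "\<not> height F v \<le> c"
  then have less: "c - height F v < 0" by simp
  let ?w = "\<lambda>m. \<Sum>l\<in>UNIV. v l * Poly_Mapping.lookup m l"
  \<comment> \<open>The exponents on the face of the Newton polytope exposed by \<open>v\<close>;
    \<open>G\<close> below is the corresponding initial form.\<close>
  define A where "A = {m \<in> Poly_Mapping.keys F. ?w m = height F v}"
  have [simp]: "finite A" by (simp add: A_def)
  define G where "G = (\<Sum>m\<in>A. Poly_Mapping.single m (Poly_Mapping.lookup F m))"
  obtain m0 where m0: "m0 \<in> Poly_Mapping.keys F" "height F v = ?w m0"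
    using height_attained[OF assms(1)] .
  have "Poly_Mapping.lookup G m0 = (\<Sum>m\<in>A. if m = m0 then Poly_Mapping.lookup F m0 else 0)"
    unfolding G_def lookup_sum by (rule sum.cong) (auto simp: lookup_single)
  also have "\<dots> \<noteq> 0" using m0 by (auto simp: A_def in_keys_iff)
  finally have "G \<noteq> 0" by auto
  then obtain y :: "'n \<Rightarrow> real" where y: "\<And>l. 0 < y l" and Gy: "laurent_eval G y \<noteq> laurent_eval 0 y"
    using laurent_eqI_positive[of G 0] by blast
  have Gy': "laurent_eval G y = (\<Sum>m\<in>A. of_rat (Poly_Mapping.lookup F m) * laurent_char y m)"
    by (simp add: G_def laurent_eval_lin_ext)
  have fin: "finite (range y)" by simp
  have minpos: "0 < Min (range y)" using y by (subst Min_gr_iff) auto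
  from growth minpos obtain C where C: "\<And>t \<rho>. 1 \<le> t \<Longrightarrow>
      (\<And>l. Min (range y) \<le> \<rho> l \<and> \<rho> l \<le> Max (range y)) \<Longrightarrow>
      \<bar>laurent_eval F (\<lambda>l. t powi v l * \<rho> l)\<bar> \<le> C * t powi c"
    by (rule growth_leD[where \<beta> = "Max (range y)"]) blast
  \<comment> \<open>The rescaled value along integer parameters; \<open>Suc n\<close> keeps the
    parameter at least 1.\<close>
  define q where "q n = laurent_eval F (\<lambda>l. real (Suc n) powi v l * y l) * real (Suc n) powi (- height F v)" for n
  have "q \<longlonglongrightarrow> 0"
  proof (rule tendsto_rabs_zero_cancel, rule tendsto_sandwich)
    show "\<forall>\<^sub>F n in sequentially. 0 \<le> \<bar>q n\<bar>" by simp
    show "\<forall>\<^sub>F n in sequentially. \<bar>q n\<bar> \<le> C * real (Suc n) powi (c - height F v)"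
    proof (rule always_eventually, rule allI)
      fix n
      have "\<bar>laurent_eval F (\<lambda>l. real (Suc n) powi v l * y l)\<bar> \<le> C * real (Suc n) powi c"
        by (rule C) auto
      then have "\<bar>q n\<bar> \<le> C * real (Suc n) powi c * real (Suc n) powi (- height F v)"
        unfolding q_def abs_mult by (simp add: mult_right_mono)
      also have "\<dots> = C * real (Suc n) powi (c - height F v)"
        using power_int_add[of "real (Suc n)" c "- height F v"] by simp
      finally show "\<bar>q n\<bar> \<le> C * real (Suc n) powi (c - height F v)" .
    qed
    show "(\<lambda>n. C * real (Suc n) powi (c - height F v)) \<longlonglongrightarrow> 0"
      using tendsto_mult[OF tendsto_const tendsto_powi_neg[OF less]] by simp
  qed simp
  moreover have "q \<longlonglongrightarrow> laurent_eval G y"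
  proof -
    have q: "q n = (\<Sum>m\<in>Poly_Mapping.keys F. of_rat (Poly_Mapping.lookup F m) * laurent_char y m *
        real (Suc n) powi (?w m - height F v))" for n
    proof -
      have "real (Suc n) powi (?w m - height F v) = real (Suc n) powi ?w m * real (Suc n) powi (- height F v)" for m
        using power_int_add[of "real (Suc n)" "?w m" "- height F v"] by simp
      note split = this
      show ?thesis
        unfolding q_def split by (subst laurent_eval_scale) (simp_all add: sum_distrib_left mult_ac del: of_nat_Suc)
    qed
    have "(\<lambda>n. real (Suc n) powi (?w m - height F v)) \<longlonglongrightarrow> (if m \<in> A then 1 else 0)"
      if "m \<in> Poly_Mapping.keys F" for m
    proof (cases "m \<in> A")
      case True
      then show ?thesis by (simp add: A_def)
    next
      case False
      then have "?w m - height F v < 0"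
        using that height_ge[OF that, of v] by (auto simp: A_def)
      then show ?thesis using False tendsto_powi_neg by simp
    qed
    then have "(\<lambda>n. q n) \<longlonglongrightarrow> (\<Sum>m\<in>Poly_Mapping.keys F. of_rat (Poly_Mapping.lookup F m) *
        laurent_char y m * (if m \<in> A then 1 else 0))"
      unfolding q by (intro tendsto_sum tendsto_mult tendsto_const)
    also have "(\<Sum>m\<in>Poly_Mapping.keys F. of_rat (Poly_Mapping.lookup F m) *
        laurent_char y m * (if m \<in> A then 1 else 0)) = laurent_eval G y"
      unfolding Gy' by (rule sum.mono_neutral_cong_right) (auto simp: A_def)
    finally show ?thesis .
  qed
  ultimately have "laurent_eval G y = 0" by (rule LIMSEQ_unique[symmetric])
  with Gy show False by (simp add: laurent_eval_lin_ext)
qed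

text \<open>The height is thus determined by growth alone, which is what allows it to be compared
  before and after a mutation.\<close>

lemma growth_le_iff_height:
  fixes F :: "'n::finite laurent"
  assumes "F \<noteq> 0"
  shows "growth_le (laurent_eval F) v c \<longleftrightarrow> height F v \<le> c"
proof
  assume le: "height F v \<le> c"
  show "growth_le (laurent_eval F) v c"
    unfolding growth_le_def
  proof (intro allI impI)
    fix \<alpha> \<beta> :: real assume "0 < \<alpha>"
    with growth_le_height[of F v] obtain C where C: "\<And>t \<rho>. 1 \<le> t \<Longrightarrow> (\<And>l. \<alpha> \<le> \<rho> l \<and> \<rho> l \<le> \<beta>) \<Longrightarrow>
        \<bar>laurent_eval F (\<lambda>l. t powi v l * \<rho> l)\<bar> \<le> C * t powi height F v"
      by (rule growth_leD[where \<beta> = \<beta>]) blast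
    show "\<exists>C. \<forall>t\<ge>1. \<forall>\<rho>. (\<forall>l. \<alpha> \<le> \<rho> l \<and> \<rho> l \<le> \<beta>) \<longrightarrow>
        \<bar>laurent_eval F (\<lambda>l. t powi v l * \<rho> l)\<bar> \<le> C * t powi c"
    \<comment> \<open>The absolute value makes the constant nonnegative, so that the exponent may be
      enlarged.\<close>
    proof (rule exI[of _ "\<bar>C\<bar>"], intro allI impI)
      fix t :: real and \<rho> :: "'n \<Rightarrow> real" assume t: "1 \<le> t" and "\<forall>l. \<alpha> \<le> \<rho> l \<and> \<rho> l \<le> \<beta>"
      then have "\<bar>laurent_eval F (\<lambda>l. t powi v l * \<rho> l)\<bar> \<le> C * t powi height F v"
        by (intro C) auto
      also have "\<dots> \<le> \<bar>C\<bar> * t powi c"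
        using t le by (intro mult_mono power_int_increasing) auto
      finally show "\<bar>laurent_eval F (\<lambda>l. t powi v l * \<rho> l)\<bar> \<le> \<bar>C\<bar> * t powi c" .
    qed
  qed
qed (rule height_le_growth[OF assms])

section \<open>A single mutation and its tropicalization\<close>

text \<open>A vanishing coordinate would correspond to the value 1 at the all-ones real
  point.\<close>

lemma free_generators_nonzero:
  assumes "free_generators y"
  shows "y k \<noteq> 0"
  using corresponds_zero[OF assms, of "\<lambda>_. 1 :: real" 1]
    corresponds_var[of y "\<lambda>_. 1 :: real" k] by auto

text \<open>The data of one mutation: \<open>b\<close> is the column of the exchange matrix with
  index \<open>i\<close>, \<open>d\<close> the diagonal entry of \<open>R\<close>, and
  \<open>Z\<close> the exchange polynomial in one variable.\<close>

locale exchange =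
  fixes i :: "'n::finite" and b :: "'n \<Rightarrow> int" and d :: nat and Z :: "nat poly"
  assumes b_self: "b i = 0" and coeff_0: "coeff Z 0 = 1" and coeff_d: "coeff Z d = 1"
begin

definition expo :: "nat \<Rightarrow> 'n \<Rightarrow> int" where
  "expo a k = int a * pos_part (b k) + int (d - a) * pos_part (- b k)"

definition val :: "('n \<Rightarrow> 'k::field_char_0) \<Rightarrow> 'k" where
  "val y = (\<Sum>a\<le>d. of_nat (coeff Z a) * (\<Prod>k\<in>UNIV. y k powi expo a k))"

definition mut :: "('n \<Rightarrow> 'k::field_char_0) \<Rightarrow> 'n \<Rightarrow> 'k" where
  "mut y = y(i := val y / y i)"

text \<open>Tropicalization of \<open>val\<close>: sums become maxima and powers become multiples.
  The exponent of a term is linear in its index, so the maximum over the terms is reached at one of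
  the two ends, whose coefficients are 1.\<close>

definition trop_val :: "('n \<Rightarrow> int) \<Rightarrow> int" where
  "trop_val v = int d * max (\<Sum>k\<in>UNIV. pos_part (b k) * v k) (\<Sum>k\<in>UNIV. pos_part (- b k) * v k)"

definition trop :: "('n \<Rightarrow> int) \<Rightarrow> 'n \<Rightarrow> int" where
  "trop v = v(i := trop_val v - v i)"

lemma expo_self [simp]: "expo a i = 0"
  by (simp add: expo_def b_self pos_part_def)

text \<open>The exchange polynomial does not involve the variable being mutated, because
  \<open>b i = 0\<close>. This and its tropical counterpart make \<open>mut\<close> and
  \<open>trop\<close> involutions.\<close>

lemma val_upd [simp]: "val (y(i := c)) = val y"
  unfolding val_def by (intro sum.cong arg_cong2[of _ _ _ _ "(*)"] prod.cong) auto

lemma trop_val_upd [simp]: "trop_val (v(i := c)) = trop_val v"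
proof -
  \<comment> \<open>The factor \<open>s\<close> treats both sums in \<open>trop_val\<close> at once,
    by the choices 1 and -1.\<close>
  have "(\<Sum>k\<in>UNIV. pos_part (s * b k) * (v(i := c)) k) = (\<Sum>k\<in>UNIV. pos_part (s * b k) * v k)" for s
    by (rule sum.cong) (auto simp: b_self pos_part_def)
  from this[of 1] this[of "-1"] show ?thesis by (simp add: trop_val_def)
qed

lemma trop_trop [simp]: "trop (trop v) = v"
  by (simp add: trop_def)

lemma mut_mut: "y i \<noteq> 0 \<Longrightarrow> val y \<noteq> 0 \<Longrightarrow> mut (mut y) = y"
  by (simp add: mut_def)

lemma val_positive:
  fixes y :: "'n \<Rightarrow> real"
  assumes "\<And>k. 0 < y k"
  shows "0 < val y"
proof -
  have pos: "0 < (\<Prod>k\<in>UNIV. y k powi expo a k)" for a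
    using assms by (simp add: prod_pos)
  have "0 < of_nat (coeff Z 0) * (\<Prod>k\<in>UNIV. y k powi expo 0 k)"
    using pos by (simp add: coeff_0)
  also have "\<dots> \<le> val y"
    unfolding val_def by (rule member_le_sum) (use pos in \<open>auto simp: less_imp_le\<close>)
  finally show ?thesis .
qed

lemma mut_positive:
  fixes y :: "'n \<Rightarrow> real"
  shows "(\<And>k. 0 < y k) \<Longrightarrow> 0 < mut y k"
  by (simp add: mut_def val_positive)

lemma corresponds_val:
  assumes "\<And>k. x k \<noteq> 0" "\<And>k. y k \<noteq> 0"
  shows "corresponds x y (val x) (val y)"
  unfolding val_def
  by (intro corresponds_sum corresponds_mult corresponds_of_nat corresponds_prod corresponds_powi
      corresponds_var assms)

lemma corresponds_mut:
  assumes "\<And>k. x k \<noteq> 0" "\<And>k. y k \<noteq> 0"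
  shows "corresponds x y (mut x k) (mut y k)"
  using corresponds_divide[OF corresponds_val[OF assms] corresponds_var[of x y i] assms]
    corresponds_var[of x y k]
  by (simp add: mut_def)

text \<open>Otherwise, by transfer to the all-ones real point, a positive value would be
  zero.\<close>

lemma val_nonzero:
  assumes "free_generators y"
  shows "val y \<noteq> 0"
proof
  assume "val y = 0"
  moreover have "corresponds y (\<lambda>_. 1 :: real) (val y) (val (\<lambda>_. 1))"
    by (rule corresponds_val) (use free_generators_nonzero[OF assms] in auto)
  ultimately have "val (\<lambda>_. 1 :: real) = 0"
    using corresponds_zero[OF assms] by simp
  then show False using val_positive[of "\<lambda>_. 1"] by simp
qed

text \<open>A polynomial relation at \<open>mut y\<close> transfers to
  \<open>mut (mut z) = z\<close> for every positive real \<open>z\<close>, hence is trivial.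
  Generation follows because \<open>y = mut (mut y)\<close> is rational in
  \<open>mut y\<close>.\<close>

lemma free_generators_mut:
  fixes y :: "'n \<Rightarrow> 'k::field_char_0"
  assumes "free_generators y"
  shows "free_generators (mut y)"
proof -
  note nz = free_generators_nonzero[OF assms]
  have mut_nz: "mut y k \<noteq> 0" for k
    using nz val_nonzero[OF assms] by (simp add: mut_def)
  have mut_back: "mut (mut y) = y"
    by (rule mut_mut) (use nz val_nonzero[OF assms] in auto)
  show ?thesis
    unfolding free_generators_def
  proof (intro conjI allI impI)
    fix T :: "'n mpol" assume T: "mpol_eval T (mut y) = 0"
    show "T = 0"
    proof (rule mpol_eq_0I_positive)
      fix z :: "'n \<Rightarrow> real" assume z: "\<And>k. 0 < z k"
      have "corresponds y (mut z) (mpol_eval T (mut y)) (mpol_eval T (mut (mut z)))"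
        by (intro corresponds_mpol_eval corresponds_mut nz)
          (use mut_positive[OF z] in \<open>simp add: less_imp_neq[symmetric]\<close>)
      moreover have "mut (mut z) = z"
        by (rule mut_mut) (use z val_positive[OF z] in \<open>auto simp: less_imp_neq[symmetric]\<close>)
      ultimately show "mpol_eval T z = 0"
        using T corresponds_zero[OF assms] by simp
    qed
  next
    fix a :: 'k
    obtain S T where T: "mpol_eval T y \<noteq> 0" and a: "a = mpol_eval S y / mpol_eval T y"
      using assms unfolding free_generators_def by blast
    \<comment> \<open>Correspondence of the point with itself expresses being a rational function of
      \<open>mut y\<close>.\<close>
    have "corresponds (mut y) (mut y) (y k) (y k)" for k
      using corresponds_mut[of "mut y" "mut y" k, OF mut_nz mut_nz] by (simp add: mut_back)
    then have "corresponds (mut y) (mut y) a a"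
      unfolding a by (intro corresponds_divide corresponds_mpol_eval T)
    then show "\<exists>S T. mpol_eval T (mut y) \<noteq> 0 \<and> a = mpol_eval S (mut y) / mpol_eval T (mut y)"
      unfolding corresponds_def by blast
  qed
qed

lemma sum_expo:
  assumes "a \<le> d"
  shows "(\<Sum>k\<in>UNIV. v k * expo a k)
    = int a * (\<Sum>k\<in>UNIV. pos_part (b k) * v k) + int (d - a) * (\<Sum>k\<in>UNIV. pos_part (- b k) * v k)"
  by (simp add: expo_def sum_distrib_left sum.distrib[symmetric] algebra_simps)

lemma val_scale:
  fixes t :: real
  assumes "0 < t"
  shows "val (\<lambda>l. t powi v l * \<rho> l) = (\<Sum>a\<le>d. of_nat (coeff Z a) *
    (t powi (\<Sum>k\<in>UNIV. v k * expo a k) * (\<Prod>k\<in>UNIV. \<rho> k powi expo a k)))"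
  by (simp add: val_def prod_powi_scale[OF assms])

text \<open>All summands are nonnegative. Each exponent of \<open>t\<close> is at most
  \<open>trop_val v\<close>, which gives the upper bound; one of the two end terms reaches it with
  coefficient 1, which gives the lower bound.\<close>

lemma val_bounds:
  fixes \<alpha> \<beta> :: real
  assumes \<alpha>: "0 < \<alpha>"
  obtains \<alpha>' \<beta>' where "0 < \<alpha>'"
    "\<And>t \<rho>. 1 \<le> t \<Longrightarrow> (\<And>l. \<alpha> \<le> \<rho> l \<and> \<rho> l \<le> \<beta>) \<Longrightarrow>
      \<alpha>' * t powi trop_val v \<le> val (\<lambda>l. t powi v l * \<rho> l) \<and>
      val (\<lambda>l. t powi v l * \<rho> l) \<le> \<beta>' * t powi trop_val v"
proof -
  let ?p = "\<Sum>k\<in>UNIV. pos_part (b k) * v k" and ?q = "\<Sum>k\<in>UNIV. pos_part (- b k) * v k"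
  define L where "L a = (\<Prod>k\<in>UNIV. \<alpha> powi expo a k)" for a
  define U where "U a = (\<Prod>k\<in>UNIV. \<beta> powi expo a k)" for a
  have L: "0 < L a" for a
    using \<alpha> by (simp add: L_def prod_pos)
  define \<alpha>' where "\<alpha>' = min (L 0) (L d)"
  define \<beta>' where "\<beta>' = (\<Sum>a\<le>d. of_nat (coeff Z a) * U a)"
  have expo_nonneg: "0 \<le> expo a k" for a k
    by (simp add: expo_def pos_part_def)
  show thesis
  proof (rule that[of \<alpha>' \<beta>'])
    show "0 < \<alpha>'" using L by (simp add: \<alpha>'_def)
    fix t :: real and \<rho> :: "'n \<Rightarrow> real"
    assume t: "1 \<le> t" and \<rho>: "\<And>l. \<alpha> \<le> \<rho> l \<and> \<rho> l \<le> \<beta>"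
    let ?R = "\<lambda>a. \<Prod>k\<in>UNIV. \<rho> k powi expo a k"
    let ?T = "\<lambda>a. t powi (\<Sum>k\<in>UNIV. v k * expo a k)"
    have pos: "0 < \<rho> l" for l using \<alpha> \<rho> less_le_trans by blast
    have LR: "L a \<le> ?R a" and RU: "?R a \<le> U a" for a
      unfolding L_def U_def
      by (rule prod_mono; use \<alpha> \<rho> pos expo_nonneg in \<open>auto intro!: power_int_mono simp: less_imp_le\<close>)+
    have R: "0 \<le> ?R a" for a using L LR order.trans less_imp_le by meson
    have le: "?T a \<le> t powi trop_val v" if "a \<le> d" for a
    proof (rule power_int_increasing)
      have "int a * ?p + int (d - a) * ?q \<le> int a * max ?p ?q + int (d - a) * max ?p ?q"
        by (intro add_mono mult_left_mono) auto
      also have "\<dots> = trop_val v"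
        using that by (simp add: trop_val_def distrib_right[symmetric])
      finally show "(\<Sum>k\<in>UNIV. v k * expo a k) \<le> trop_val v"
        using that by (simp add: sum_expo)
    qed (use t in auto)
    have val: "val (\<lambda>l. t powi v l * \<rho> l) = (\<Sum>a\<le>d. of_nat (coeff Z a) * (?T a * ?R a))"
      using t by (intro val_scale) auto
    \<comment> \<open>The end of the sum at which the larger of the two linear forms is multiplied
      by \<open>d\<close>.\<close>
    define a0 where "a0 = (if ?q \<le> ?p then d else 0)"
    have a0: "a0 \<le> d" "coeff Z a0 = 1" "(\<Sum>k\<in>UNIV. v k * expo a0 k) = trop_val v" "\<alpha>' \<le> L a0"
      by (auto simp: a0_def coeff_0 coeff_d trop_val_def sum_expo max_def \<alpha>'_def)
    have "\<alpha>' * t powi trop_val v \<le> of_nat (coeff Z a0) * (?T a0 * ?R a0)"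
      using t a0 LR[of a0] by (simp add: mult.commute mult_left_mono)
    also have "\<dots> \<le> (\<Sum>a\<le>d. of_nat (coeff Z a) * (?T a * ?R a))"
      by (rule member_le_sum) (use a0 t R in auto)
    finally have lower: "\<alpha>' * t powi trop_val v \<le> val (\<lambda>l. t powi v l * \<rho> l)"
      by (simp add: val)
    have "val (\<lambda>l. t powi v l * \<rho> l) \<le> (\<Sum>a\<le>d. of_nat (coeff Z a) * (t powi trop_val v * U a))"
      unfolding val by (intro sum_mono mult_left_mono mult_mono le RU R) (use t in auto)
    also have "\<dots> = \<beta>' * t powi trop_val v"
      by (simp add: \<beta>'_def sum_distrib_left sum_distrib_right mult_ac)
    finally show "\<alpha>' * t powi trop_val v \<le> val (\<lambda>l. t powi v l * \<rho> l) \<and>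
        val (\<lambda>l. t powi v l * \<rho> l) \<le> \<beta>' * t powi trop_val v"
      using lower by simp
  qed
qed

text \<open>Mutation maps \<open>t powi v * \<rho>\<close> to
  \<open>t powi trop v * \<rho>'\<close>, where \<rho>' lies in a box depending only on the box of
  \<rho>.\<close>

lemma growth_le_mut:
  fixes f :: "('n \<Rightarrow> real) \<Rightarrow> real"
  assumes "growth_le f (trop v) c"
  shows "growth_le (\<lambda>y. f (mut y)) v c"
  unfolding growth_le_def
proof (intro allI impI)
  fix \<alpha> \<beta> :: real assume \<alpha>: "0 < \<alpha>"
  obtain \<alpha>' \<beta>' where \<alpha>': "0 < \<alpha>'" and val:
    "\<And>t \<rho>. 1 \<le> t \<Longrightarrow> (\<And>l. \<alpha> \<le> \<rho> l \<and> \<rho> l \<le> \<beta>) \<Longrightarrow>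
      \<alpha>' * t powi trop_val v \<le> val (\<lambda>l. t powi v l * \<rho> l) \<and>
      val (\<lambda>l. t powi v l * \<rho> l) \<le> \<beta>' * t powi trop_val v"
    using val_bounds[OF \<alpha>, where \<beta> = \<beta> and v = v] by blast
  show "\<exists>C. \<forall>t\<ge>1. \<forall>\<rho>. (\<forall>l. \<alpha> \<le> \<rho> l \<and> \<rho> l \<le> \<beta>) \<longrightarrow>
      \<bar>f (mut (\<lambda>l. t powi v l * \<rho> l))\<bar> \<le> C * t powi c"
  \<comment> \<open>For \<open>\<beta> < \<alpha>\<close> the box is empty and the bound is
    vacuous.\<close>
  proof (cases "\<alpha> \<le> \<beta>")
    case False
    then have "\<not> (\<forall>l. \<alpha> \<le> \<rho> l \<and> \<rho> l \<le> \<beta>)" for \<rho> :: "'n \<Rightarrow> real"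
      by (meson order.trans)
    then show ?thesis by blast
  next
    case True
    \<comment> \<open>Only coordinate \<open>i\<close> of \<rho> changes, to
      \<open>u / \<rho> i\<close> with \<open>u\<close> between \<alpha>' and \<beta>'; the enlarged
      box contains it.\<close>
    define \<alpha>2 where "\<alpha>2 = min \<alpha> (\<alpha>' / \<beta>)"
    define \<beta>2 where "\<beta>2 = max \<beta> (\<beta>' / \<alpha>)"
    have "0 < \<alpha>2" using \<alpha> \<alpha>' True by (simp add: \<alpha>2_def)
    with assms obtain C where C: "\<And>t \<rho>. 1 \<le> t \<Longrightarrow> (\<And>l. \<alpha>2 \<le> \<rho> l \<and> \<rho> l \<le> \<beta>2) \<Longrightarrow>
        \<bar>f (\<lambda>l. t powi trop v l * \<rho> l)\<bar> \<le> C * t powi c"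
      by (rule growth_leD[where \<beta> = \<beta>2]) blast
    show ?thesis
    proof (rule exI[of _ C], intro allI impI)
      fix t :: real and \<rho> :: "'n \<Rightarrow> real"
      assume t: "1 \<le> t" and \<rho>: "\<forall>l. \<alpha> \<le> \<rho> l \<and> \<rho> l \<le> \<beta>"
      let ?y = "\<lambda>l. t powi v l * \<rho> l"
      have pos: "0 < \<rho> l" for l using \<alpha> \<rho> less_le_trans by blast
      define u where "u = val ?y / t powi trop_val v"
      have u: "\<alpha>' \<le> u" "u \<le> \<beta>'"
        using val[OF t, of \<rho>] \<rho> t by (auto simp: u_def field_simps)
      define \<rho>' where "\<rho>' = \<rho>(i := u / \<rho> i)"
      have "mut ?y = (\<lambda>l. t powi trop v l * \<rho>' l)"
        using t pos[of i] by (auto simp: mut_def trop_def \<rho>'_def u_def power_int_diff)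
      moreover have "\<bar>f (\<lambda>l. t powi trop v l * \<rho>' l)\<bar> \<le> C * t powi c"
      proof (rule C[OF t])
        have "\<alpha>' / \<beta> \<le> u / \<rho> i" "u / \<rho> i \<le> \<beta>' / \<alpha>"
          using u \<alpha> \<alpha>' \<rho> pos[of i] by (auto intro!: frac_le)
        then show "\<alpha>2 \<le> \<rho>' l \<and> \<rho>' l \<le> \<beta>2" for l
          using \<rho> by (auto simp: \<rho>'_def \<alpha>2_def \<beta>2_def le_max_iff_disj min_le_iff_disj)
      qed
      ultimately show "\<bar>f (mut ?y)\<bar> \<le> C * t powi c" by simp
    qed
  qed
qed

text \<open>One direction transports growth through the mutation and the permutation. The converse
  starts from \<open>trop v\<close> instead and uses that \<open>trop\<close> and, on positive
  points, \<open>mut\<close> are involutions.\<close>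

lemma growth_le_invariant:
  fixes f :: "('n \<Rightarrow> real) \<Rightarrow> real"
  assumes \<sigma>: "bij \<sigma>"
    and inv: "\<And>y. (\<And>k. 0 < y k) \<Longrightarrow> f (\<lambda>m. mut y (\<sigma> m)) = f y"
  shows "growth_le f (\<lambda>m. trop v (\<sigma> m)) c \<longleftrightarrow> growth_le f v c"
proof
  let ?g = "\<lambda>y. f (\<lambda>m. y (\<sigma> m))"
  assume "growth_le f (\<lambda>m. trop v (\<sigma> m)) c"
  then have "growth_le ?g (trop v) c"
    by (simp add: growth_le_permute[OF \<sigma>])
  then have "growth_le (\<lambda>y. ?g (mut y)) v c"
    by (rule growth_le_mut)
  then show "growth_le f v c"
    by (rule growth_le_cong) (simp add: inv)
next
  let ?g = "\<lambda>y. f (\<lambda>m. y (\<sigma> m))"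
  assume "growth_le f v c"
  then have "growth_le f (trop (trop v)) c" by simp
  then have mut: "growth_le (\<lambda>y. f (mut y)) (trop v) c"
    by (rule growth_le_mut)
  have "?g y = f (mut y)" if "\<And>k. 0 < y k" for y
  proof -
    have "mut (mut y) = y"
      by (rule mut_mut) (use that val_positive[OF that] in \<open>auto simp: less_imp_neq[symmetric]\<close>)
    then show ?thesis using inv[of "mut y"] mut_positive[OF that] by simp
  qed
  with mut have "growth_le ?g (trop v) c"
    by (rule growth_le_cong)
  then show "growth_le f (\<lambda>m. trop v (\<sigma> m)) c"
    by (simp add: growth_le_permute[OF \<sigma>])
qed

end

section \<open>Exponent ranges of an invariant\<close>

definition top_exp :: "'n::finite laurent \<Rightarrow> 'n \<Rightarrow> int" where
  "top_exp F j = height F ((\<lambda>_. 0)(j := 1))"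

text \<open>The negative of the least exponent of the variable; for \<open>F\<close> of type \<eta>
  over \<open>d\<close> it is the component of \<open>d\<close>.\<close>

definition pole_order :: "'n::finite laurent \<Rightarrow> 'n \<Rightarrow> int" where
  "pole_order F j = height F ((\<lambda>_. 0)(j := - 1))"

definition width :: "'n::finite laurent \<Rightarrow> 'n \<Rightarrow> int" where
  "width F j = top_exp F j + pole_order F j"

lemma sum_axis:
  fixes g :: "'n::finite \<Rightarrow> int"
  shows "(\<Sum>l\<in>UNIV. ((\<lambda>_. 0)(j := s)) l * g l) = s * g j"
    and "(\<Sum>l\<in>UNIV. g l * ((\<lambda>_. 0)(j := s)) l) = g j * s"
  by (simp_all add: fun_upd_def if_distrib if_distribR cong: if_cong)

lemma sum_axis2:
  fixes g :: "'n::finite \<Rightarrow> int"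
  assumes "k \<noteq> j"
  shows "(\<Sum>l\<in>UNIV. ((\<lambda>_. 0)(j := s, k := c)) l * g l) = s * g j + c * g k"
proof -
  have "(\<Sum>l\<in>UNIV. ((\<lambda>_. 0)(j := s, k := c)) l * g l)
      = (\<Sum>l\<in>UNIV. ((\<lambda>_. 0)(j := s)) l * g l + ((\<lambda>_. 0)(k := c)) l * g l)"
    by (rule sum.cong) (use assms in auto)
  then show ?thesis by (simp only: sum.distrib sum_axis)
qed

lemma top_exp_ge: "m \<in> Poly_Mapping.keys F \<Longrightarrow> Poly_Mapping.lookup m j \<le> top_exp F j"
  using height_ge[of m F "(\<lambda>_. 0)(j := 1)"] by (simp add: top_exp_def sum_axis del: fun_upd_apply)

lemma pole_order_ge: "m \<in> Poly_Mapping.keys F \<Longrightarrow> - Poly_Mapping.lookup m j \<le> pole_order F j"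
  using height_ge[of m F "(\<lambda>_. 0)(j := - 1)"] by (simp add: pole_order_def sum_axis del: fun_upd_apply)

lemma top_exp_attained:
  assumes "F \<noteq> 0"
  obtains m where "m \<in> Poly_Mapping.keys F" "top_exp F j = Poly_Mapping.lookup m j"
  using height_attained[OF assms, of "(\<lambda>_. 0)(j := 1)"] unfolding sum_axis top_exp_def by auto

lemma width_nonneg:
  assumes "F \<noteq> 0"
  shows "0 \<le> width F j"
proof -
  obtain m where "m \<in> Poly_Mapping.keys F"
    using top_exp_attained[OF assms, of j] by metis
  then show ?thesis
    using top_exp_ge[of m F j] pole_order_ge[of m F j] by (simp add: width_def)
qed

text \<open>An instance of subadditivity of the support function when \<open>c\<close> is
  nonnegative. In general, it suffices to test a monomial with the top exponent in variable
  \<open>k\<close>.\<close>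

lemma top_exp_mult_le:
  assumes "F \<noteq> 0" "k \<noteq> l"
  shows "c * top_exp F k \<le> height F ((\<lambda>_. 0)(l := 1, k := c)) + pole_order F l"
proof -
  obtain m where m: "m \<in> Poly_Mapping.keys F" "top_exp F k = Poly_Mapping.lookup m k"
    using top_exp_attained[OF assms(1)] .
  from height_ge[OF m(1), of "(\<lambda>_. 0)(l := 1, k := c)"] pole_order_ge[OF m(1), of l] m(2)
  show ?thesis by (simp add: sum_axis2[OF assms(2)] del: fun_upd_apply)
qed

lemma axis_permute:
  assumes "bij \<sigma>"
  shows "(\<lambda>m. (v(j := s)) (\<sigma> m)) = (\<lambda>m. v (\<sigma> m))(inv_into UNIV \<sigma> j := s)"
  using assms by (auto simp: fun_eq_iff bij_is_inj bij_is_surj surj_f_inv_f)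

context exchange
begin

lemma trop_val_axis:
  "trop_val ((\<lambda>_. 0)(j := s)) = int d * max (pos_part (b j) * s) (pos_part (- b j) * s)"
  by (simp only: trop_val_def sum_axis)

lemma trop_axis_self: "trop ((\<lambda>_. 0)(i := s)) = (\<lambda>_. 0)(i := - s)"
  by (simp add: trop_def trop_val_axis b_self pos_part_def del: trop_val_upd)

text \<open>Both competing terms of the maximum are nonpositive and one of them is zero, so the
  tropical value vanishes.\<close>

lemma trop_axis_neg: "j \<noteq> i \<Longrightarrow> trop ((\<lambda>_. 0)(j := - 1)) = (\<lambda>_. 0)(j := - 1)"
  by (auto simp: trop_def trop_val_axis pos_part_def fun_eq_iff simp del: trop_val_upd)

text \<open>At most one of the two positive parts of \<open>b j\<close> is nonzero, and the larger
  one is \<open>\<bar>b j\<bar>\<close>.\<close>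

lemma trop_axis2:
  assumes "j \<noteq> i"
  shows "trop ((\<lambda>_. 0)(j := 1, i := c)) = (\<lambda>_. 0)(j := 1, i := int d * \<bar>b j\<bar> - c)"
proof -
  have "trop_val ((\<lambda>_. 0)(j := 1)) = int d * \<bar>b j\<bar>"
    unfolding trop_val_axis by (auto simp: pos_part_def)
  then show ?thesis using assms by (simp add: trop_def)
qed

context
  fixes \<sigma> :: "'n \<Rightarrow> 'n" and F :: "'n laurent"
  assumes \<sigma>: "bij \<sigma>" and F: "F \<noteq> 0"
    and inv: "\<And>y :: 'n \<Rightarrow> real. (\<And>k. 0 < y k) \<Longrightarrow> laurent_eval F (\<lambda>m. mut y (\<sigma> m)) = laurent_eval F y"
begin

text \<open>The two integers have the same upper bounds \<open>c\<close>, since the corresponding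
  growth conditions on \<open>F\<close> are equivalent.\<close>

lemma height_invariant: "height F (\<lambda>m. trop v (\<sigma> m)) = height F v"
proof -
  have "height F (\<lambda>m. trop v (\<sigma> m)) \<le> c \<longleftrightarrow> height F v \<le> c" for c
    using growth_le_invariant[of \<sigma> "laurent_eval F", OF \<sigma> inv] growth_le_iff_height[OF F] by simp
  from this[of "height F v"] this[of "height F (\<lambda>m. trop v (\<sigma> m))"] show ?thesis by simp
qed

lemma pole_order_permute: "j \<noteq> i \<Longrightarrow> pole_order F (inv_into UNIV \<sigma> j) = pole_order F j"
  using height_invariant[of "(\<lambda>_. 0)(j := - 1)"]
  by (simp add: trop_axis_neg axis_permute[OF \<sigma>] pole_order_def del: fun_upd_apply)

text \<open>The pole orders and their permuted copies have equal sums, and all terms other than the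
  one at \<open>i\<close> are already known to agree.\<close>

lemma pole_order_permute_self: "pole_order F (inv_into UNIV \<sigma> i) = pole_order F i"
proof -
  have "(\<Sum>j\<in>UNIV. pole_order F (inv_into UNIV \<sigma> j)) = (\<Sum>j\<in>UNIV. pole_order F j)"
    using sum.reindex_bij_betw[OF bij_imp_bij_inv[OF \<sigma>]] .
  moreover have "(\<Sum>j\<in>UNIV - {i}. pole_order F (inv_into UNIV \<sigma> j)) = (\<Sum>j\<in>UNIV - {i}. pole_order F j)"
    by (rule sum.cong) (auto simp: pole_order_permute)
  ultimately show ?thesis
    using sum.remove[of UNIV i "\<lambda>j. pole_order F (inv_into UNIV \<sigma> j)"]
      sum.remove[of UNIV i "pole_order F"] by simp
qed

text \<open>Tropicalization negates the axis direction of \<open>i\<close>, and the relabelling by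
  the inverse of \<sigma> does not change the pole order there.\<close>

lemma top_exp_self: "top_exp F i = pole_order F i"
  using height_invariant[of "(\<lambda>_. 0)(i := 1)"] pole_order_permute_self
  by (simp only: trop_axis_self axis_permute[OF \<sigma>] pole_order_def top_exp_def)

lemma top_exp_permute_self: "top_exp F (inv_into UNIV \<sigma> i) = pole_order F i"
  using height_invariant[of "(\<lambda>_. 0)(i := - 1)"]
  by (simp only: trop_axis_self axis_permute[OF \<sigma>] pole_order_def top_exp_def minus_minus)

lemma width_self: "width F i = 2 * pole_order F i"
  by (simp add: width_def top_exp_self)

lemma width_permute_self: "width F (inv_into UNIV \<sigma> i) = width F i"
  by (simp add: width_def top_exp_self top_exp_permute_self pole_order_permute_self)

text \<open>Up to relabelling, the direction of \<open>j\<close> is carried to itself plus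
  \<open>int d * \<bar>b j\<bar>\<close> times that of \<open>i\<close>. Subadditivity then bounds
  this multiple of the top exponent at \<open>i\<close>, which is half the width there, by
  \<open>width F j\<close>.\<close>

lemma width_ge: "int d * \<bar>b j\<bar> * width F i \<le> 2 * width F j"
proof (cases "j = i")
  case True
  then show ?thesis using width_nonneg[OF F, of i] by (simp add: b_self)
next
  case False
  let ?\<tau> = "inv_into UNIV \<sigma>"
  have ne: "?\<tau> i \<noteq> ?\<tau> j"
    using False \<sigma> by (metis bij_is_surj surj_f_inv_f)
  have "top_exp F j = height F ((\<lambda>_. 0)(?\<tau> j := 1, ?\<tau> i := int d * \<bar>b j\<bar>))"
    \<comment> \<open>The entry \<open>i := 0\<close> brings the axis direction into the shape
      required by \<open>trop_axis2\<close>.\<close>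
    using height_invariant[of "(\<lambda>_. 0)(j := 1, i := 0)"] False
    by (simp add: trop_axis2 axis_permute[OF \<sigma>] top_exp_def del: fun_upd_apply)
       (simp add: fun_upd_idem)
  then have "int d * \<bar>b j\<bar> * top_exp F (?\<tau> i) \<le> top_exp F j + pole_order F (?\<tau> j)"
    using top_exp_mult_le[OF F ne] by simp
  then show ?thesis
    using pole_order_permute[OF False]
    by (simp add: width_self width_def[of F j] top_exp_permute_self)
qed

text \<open>The same argument in reverse: the coefficient \<open>?c\<close> at \<open>i\<close> is
  chosen to cancel under tropicalization, leaving the axis of \<open>\<sigma> l\<close>, which is
  relabelled to that of \<open>l\<close>.\<close>

lemma width_permute_ge: "int d * \<bar>b (\<sigma> l)\<bar> * width F i \<le> 2 * width F l"
proof (cases "\<sigma> l = i")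
  case True
  then show ?thesis using width_nonneg[OF F, of l] by (simp add: b_self)
next
  case False
  let ?\<tau> = "inv_into UNIV \<sigma>" and ?c = "int d * \<bar>b (\<sigma> l)\<bar>"
  have l: "?\<tau> (\<sigma> l) = l" using \<sigma> by (simp add: bij_is_inj)
  have "trop ((\<lambda>_. 0)(\<sigma> l := 1, i := ?c)) = (\<lambda>_. 0)(\<sigma> l := 1)"
    using False by (auto simp: trop_axis2)
  then have "top_exp F l = height F ((\<lambda>_. 0)(\<sigma> l := 1, i := ?c))"
    using height_invariant[of "(\<lambda>_. 0)(\<sigma> l := 1, i := ?c)"]
    by (simp add: axis_permute[OF \<sigma>] l top_exp_def del: fun_upd_apply)
  then have "?c * top_exp F i \<le> top_exp F l + pole_order F (\<sigma> l)"
    using top_exp_mult_le[OF F, of i "\<sigma> l" ?c] False by simp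
  then show ?thesis
    using pole_order_permute[OF False] by (simp add: l width_self width_def[of F l] top_exp_self)
qed

end

end

section \<open>Invariants of a seed\<close>

lemma mpol_var_dvdI:
  assumes "\<And>m. m \<in> Poly_Mapping.keys T \<Longrightarrow> Poly_Mapping.lookup m i \<noteq> 0"
  shows "mpol_var i dvd T"
proof -
  have "mpol_var i dvd (\<Sum>m\<in>Poly_Mapping.keys T. Poly_Mapping.single m (Poly_Mapping.lookup T m))"
  proof (rule dvd_sum)
    fix m assume "m \<in> Poly_Mapping.keys T"
    then have "Poly_Mapping.lookup m i \<noteq> 0" by (rule assms)
    then have "m = Poly_Mapping.single i 1 + (m - Poly_Mapping.single i 1)"
      by (intro poly_mapping_eqI) (auto simp: lookup_add lookup_minus lookup_single when_def)
    then have "Poly_Mapping.single m (Poly_Mapping.lookup T m)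
        = mpol_var i * Poly_Mapping.single (m - Poly_Mapping.single i 1) (Poly_Mapping.lookup T m)"
      by (simp add: mpol_var_def mult_single)
    then show "mpol_var i dvd Poly_Mapping.single m (Poly_Mapping.lookup T m)"
      by (rule dvdI)
  qed
  then show ?thesis by (simp only: poly_mapping_sum_single)
qed

lemma lookup_map_int: "Poly_Mapping.lookup (Poly_Mapping.map int m) i = int (Poly_Mapping.lookup m i)"
  by (simp add: Poly_Mapping.map.rep_eq when_def)

lemma lookup_laurent_of_mpol_shift:
  "Poly_Mapping.lookup (laurent_of_mpol T * laurent_monom (- d)) (Poly_Mapping.map int m - d)
    = Poly_Mapping.lookup T m"
proof -
  have inj: "Poly_Mapping.map int m' = Poly_Mapping.map int m \<longleftrightarrow> m' = m" for m' m :: "'a \<Rightarrow>\<^sub>0 nat"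
    by (auto simp: poly_mapping_eq_iff fun_eq_iff lookup_map_int)
  have "laurent_of_mpol T * laurent_monom (- d)
      = (\<Sum>m\<in>Poly_Mapping.keys T. Poly_Mapping.single (Poly_Mapping.map int m - d) (Poly_Mapping.lookup T m))"
    by (simp add: laurent_of_mpol_def laurent_monom_def sum_distrib_right mult_single)
  then show ?thesis
    by (simp add: lookup_sum lookup_single when_def inj in_keys_iff)
qed

text \<open>Since variable \<open>i\<close> does not divide \<open>T\<close>, some monomial of
  \<open>T\<close> omits it, while another one has exponent \<open>\<eta> i\<close>. Division by the
  monomial with exponent \<open>d\<close> preserves the difference of the two exponents.\<close>

lemma has_type_width:
  assumes "has_type F \<eta> d"
  shows "F \<noteq> 0" and "int (\<eta> i) \<le> width F i"
proof -
  from assms obtain T where F: "F = laurent_of_mpol T * laurent_monom (- d)"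
    and ndvd: "\<not> mpol_var i dvd T" and \<eta>: "\<eta> i = mpol_degree i T"
    unfolding has_type_def by blast
  have key: "Poly_Mapping.map int m - d \<in> Poly_Mapping.keys F" if "m \<in> Poly_Mapping.keys T" for m
    using that by (simp add: F in_keys_iff lookup_laurent_of_mpol_shift)
  obtain m0 where m0: "m0 \<in> Poly_Mapping.keys T" "Poly_Mapping.lookup m0 i = 0"
    using mpol_var_dvdI[of T i] ndvd by metis
  have "\<eta> i \<in> (\<lambda>m. Poly_Mapping.lookup m i) ` Poly_Mapping.keys T"
    unfolding \<eta> mpol_degree_def by (rule Max_in) (use m0 in auto)
  then obtain m1 where m1: "m1 \<in> Poly_Mapping.keys T" "\<eta> i = Poly_Mapping.lookup m1 i" by blast
  show "F \<noteq> 0" using key[OF m0(1)] by auto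
  show "int (\<eta> i) \<le> width F i"
    using top_exp_ge[OF key[OF m1(1)], of i] pole_order_ge[OF key[OF m0(1)], of i] m0(2) m1(2)
    by (simp add: width_def lookup_minus lookup_map_int)
qed

text \<open>Both sides of the identity at the free generators correspond to the respective sides at
  \<open>y\<close>, and corresponding values are unique.\<close>

lemma (in exchange) invariant_positive:
  fixes x :: "'n \<Rightarrow> 'k::field_char_0" and y :: "'n \<Rightarrow> real"
  assumes x: "free_generators x" and y: "\<And>k. 0 < y k"
    and inv: "laurent_eval F (\<lambda>m. mut x (\<sigma> m)) = laurent_eval F x"
  shows "laurent_eval F (\<lambda>m. mut y (\<sigma> m)) = laurent_eval F y"
proof -
  note nz = free_generators_nonzero[OF x]
  have y_nz: "y k \<noteq> 0" and mut_y_nz: "mut y k \<noteq> 0" for k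
    using y mut_positive[OF y] by (auto simp: less_imp_neq[symmetric])
  have mut_x_nz: "mut x k \<noteq> 0" for k
    using nz val_nonzero[OF x] by (simp add: mut_def)
  have "corresponds x y (laurent_eval F (\<lambda>m. mut x (\<sigma> m))) (laurent_eval F (\<lambda>m. mut y (\<sigma> m)))"
    by (intro corresponds_laurent_eval corresponds_mut nz y_nz mut_x_nz mut_y_nz)
  moreover have "corresponds x y (laurent_eval F x) (laurent_eval F y)"
    by (intro corresponds_laurent_eval corresponds_var nz y_nz)
  ultimately show ?thesis
    using corresponds_eq[OF x] inv by simp
qed

section \<open>Mutations of a seed and the bound of part (i)\<close>

locale seed_exchange =
  fixes \<Omega> :: "('n::finite, 'k::field_char_0) seed" and i :: 'n
  assumes seed: "is_seed \<Omega>"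
begin

lemma exchange: "exchange i (\<lambda>k. exmat \<Omega> k i) (mdeg \<Omega> i) (expol \<Omega> i)"
proof
  \<comment> \<open>On the diagonal, skew-symmetrizability makes
    \<open>\<delta> i * exmat \<Omega> i i\<close> its own negative.\<close>
  from seed obtain \<delta> :: "'n \<Rightarrow> int" where "\<delta> i > 0" "\<delta> i * exmat \<Omega> i i = - (\<delta> i * exmat \<Omega> i i)"
    unfolding is_seed_def skew_symmetrizable_def by blast
  then show "exmat \<Omega> i i = 0" by simp
qed (use seed in \<open>auto simp: is_seed_def\<close>)

sublocale exchange i "\<lambda>k. exmat \<Omega> k i" "mdeg \<Omega> i" "expol \<Omega> i"
  by (rule exchange)

lemma mdeg_pos: "0 < mdeg \<Omega> i"
  using seed by (simp add: is_seed_def)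

lemma cluster_map_eq:
  assumes "y \<in> clusters"
  shows "cluster_map \<Omega> (\<sigma>, i) y = (\<lambda>m. mut y (\<sigma> m))"
  using assms
  by (simp add: cluster_map_def mutate_def permute_seed_def mut_def val_def expo_def exchange_value_def)

lemma val_isolated:
  assumes "\<forall>k. exmat \<Omega> k i = 0"
  shows "val y = of_nat (poly (expol \<Omega> i) 1)"
proof -
  have "expo a k = 0" for a k
    unfolding expo_def using assms by (simp add: pos_part_def)
  moreover have "degree (expol \<Omega> i) = mdeg \<Omega> i"
    using seed by (simp add: is_seed_def)
  ultimately show ?thesis by (simp add: val_def poly_altdef)
qed

text \<open>Mutation is an involution on clusters. Lying in the carrier of the group of bijections
  makes genuine inverses of the generators available.\<close>

lemma cluster_map_Bij: "cluster_map \<Omega> (id, i) \<in> Bij clusters"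
proof -
  let ?C = "clusters :: ('n \<Rightarrow> 'k) set"
  have inv: "mut (mut y) = y" if "y \<in> ?C" for y
    using that by (intro mut_mut) (auto simp: clusters_def free_generators_nonzero val_nonzero)
  have closed: "mut ` ?C \<subseteq> ?C"
    by (auto simp: clusters_def free_generators_mut)
  have "bij_betw mut ?C ?C"
    by (rule bij_betw_byWitness[of _ mut]) (use inv closed in auto)
  then have "bij_betw (cluster_map \<Omega> (id, i)) ?C ?C"
    using bij_betw_cong[of ?C "cluster_map \<Omega> (id, i)" mut] by (simp add: cluster_map_eq)
  then show ?thesis
    by (simp add: Bij_def cluster_map_def)
qed

context
  fixes F :: "'n laurent" and \<sigma> A
  assumes F: "F \<noteq> 0" "F \<in> invariants \<Omega> (generated_group \<Omega> A)"
    and \<sigma>: "(\<sigma>, i) \<in> A" "bij \<sigma>"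
begin

lemma invariant_positive_reals:
  fixes y :: "'n \<Rightarrow> real"
  assumes "\<And>k. 0 < y k"
  shows "laurent_eval F (\<lambda>m. mut y (\<sigma> m)) = laurent_eval F y"
proof (rule invariant_positive[OF _ assms])
  show free: "free_generators (clust \<Omega>)" using seed by (simp add: is_seed_def)
  have "cluster_map \<Omega> (\<sigma>, i) \<in> generated_group \<Omega> A"
    unfolding generated_group_def using \<sigma>(1) by (intro generate.incl imageI)
  then have "laurent_eval F (cluster_map \<Omega> (\<sigma>, i) (clust \<Omega>)) = laurent_eval F (clust \<Omega>)"
    using F(2) by (simp add: invariants_def)
  then show "laurent_eval F (\<lambda>m. mut (clust \<Omega>) (\<sigma> m)) = laurent_eval F (clust \<Omega>)"
    using free by (simp add: cluster_map_eq clusters_def)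
qed

lemmas invariant_width_ge = width_ge[OF \<sigma>(2) F(1) invariant_positive_reals]
lemmas invariant_width_permute_ge = width_permute_ge[OF \<sigma>(2) F(1) invariant_positive_reals]
lemmas invariant_width_permute_self = width_permute_self[OF \<sigma>(2) F(1) invariant_positive_reals]
lemmas invariant_top_exp_self = top_exp_self[OF \<sigma>(2) F(1) invariant_positive_reals]

end

end

text \<open>The mutation at \<open>i\<close> bounds a multiple of \<open>width F i\<close> by
  \<open>2 * width F j\<close>, the one at \<open>j\<close> bounds a multiple of
  \<open>width F j\<close> by \<open>2 * width F i\<close>. Chaining the two and cancelling the
  positive width yields the constant 4.\<close>

lemma invariant_bound:
  fixes \<Omega> :: "('n::finite, 'k::field_char_0) seed"
  assumes seed: "is_seed \<Omega>" and \<sigma>: "bij \<sigma>" "(\<sigma>, i) \<in> A" and \<tau>: "bij \<tau>" "(\<tau>, j) \<in> A"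
    and F: "F \<noteq> 0" "F \<in> invariants \<Omega> (generated_group \<Omega> A)" and pos: "0 < width F i"
  shows "int (mdeg \<Omega> i) * int (mdeg \<Omega> j) * Max {\<bar>exmat \<Omega> j i\<bar>, \<bar>exmat \<Omega> (\<sigma> j) i\<bar>} *
      Max {\<bar>exmat \<Omega> i j\<bar>, \<bar>exmat \<Omega> (\<tau> i) j\<bar>, \<bar>exmat \<Omega> (inv_into UNIV \<sigma> i) j\<bar>,
        \<bar>exmat \<Omega> (\<tau> (inv_into UNIV \<sigma> i)) j\<bar>} \<le> 4"
proof -
  interpret I: seed_exchange \<Omega> i by standard (rule seed)
  interpret J: seed_exchange \<Omega> j by standard (rule seed)
  let ?k = "inv_into UNIV \<sigma> i"
  define M1 where "M1 = Max {\<bar>exmat \<Omega> j i\<bar>, \<bar>exmat \<Omega> (\<sigma> j) i\<bar>}"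
  define M2 where "M2 = Max {\<bar>exmat \<Omega> i j\<bar>, \<bar>exmat \<Omega> (\<tau> i) j\<bar>, \<bar>exmat \<Omega> ?k j\<bar>, \<bar>exmat \<Omega> (\<tau> ?k) j\<bar>}"
  \<comment> \<open>This equality brings the two entries with row indices \<open>?k\<close> and
    \<open>\<tau> ?k\<close> into the second maximum.\<close>
  have k: "width F ?k = width F i"
    by (rule I.invariant_width_permute_self[OF F \<sigma>(2,1)])
  have "M1 \<in> {\<bar>exmat \<Omega> j i\<bar>, \<bar>exmat \<Omega> (\<sigma> j) i\<bar>}"
    unfolding M1_def by (rule Max_in) auto
  then have M1: "int (mdeg \<Omega> i) * M1 * width F i \<le> 2 * width F j"
    using I.invariant_width_ge[OF F \<sigma>(2,1), of j] I.invariant_width_permute_ge[OF F \<sigma>(2,1), of j]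
    by auto
  have M2_in: "M2 \<in> {\<bar>exmat \<Omega> i j\<bar>, \<bar>exmat \<Omega> (\<tau> i) j\<bar>, \<bar>exmat \<Omega> ?k j\<bar>, \<bar>exmat \<Omega> (\<tau> ?k) j\<bar>}"
    unfolding M2_def by (rule Max_in) auto
  then have M2: "int (mdeg \<Omega> j) * M2 * width F j \<le> 2 * width F i"
    using J.invariant_width_ge[OF F \<tau>(2,1), of i] J.invariant_width_permute_ge[OF F \<tau>(2,1), of i]
      J.invariant_width_ge[OF F \<tau>(2,1), of ?k] J.invariant_width_permute_ge[OF F \<tau>(2,1), of ?k]
    by (auto simp: k)
  have "0 \<le> M2" using M2_in by auto
  then have "int (mdeg \<Omega> j) * M2 * (int (mdeg \<Omega> i) * M1 * width F i) \<le> int (mdeg \<Omega> j) * M2 * (2 * width F j)"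
    using M1 by (intro mult_left_mono) auto
  also have "\<dots> \<le> 4 * width F i" using M2 by (simp add: algebra_simps)
  finally have "(int (mdeg \<Omega> i) * int (mdeg \<Omega> j) * M1 * M2) * width F i \<le> 4 * width F i"
    by (simp add: mult_ac)
  with pos show ?thesis unfolding M1_def M2_def by (rule mult_right_le_imp_le[rotated])
qed

lemma laurent_const_in_invariants: "laurent_const c \<in> invariants \<Omega> G"
  by (simp add: invariants_def)

section \<open>The subalgebra generated by one Laurent polynomial\<close>

lemma laurent_const_add: "laurent_const (a + b) = laurent_const a + laurent_const b"
  by (simp add: laurent_const_def single_add)

lemma laurent_const_mult: "laurent_const (a * b) = laurent_const a * laurent_const b"
  by (simp add: laurent_const_def mult_single)

lemma laurent_const_0 [simp]: "laurent_const 0 = 0"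
  by (simp add: laurent_const_def)

lemma laurent_const_sum: "laurent_const (sum f A) = (\<Sum>a\<in>A. laurent_const (f a))"
  by (induction A rule: infinite_finite_induct) (auto simp: laurent_const_add)

lemma generated_algebra_const: "laurent_const c \<in> generated_algebra f"
  unfolding generated_algebra_def
  by (rule range_eqI[of _ _ "[:c:]"]) (simp add: map_poly_pCons)

lemma generated_algebra_generator: "f \<in> generated_algebra f"
  unfolding generated_algebra_def
  by (rule range_eqI[of _ _ "[:0, 1:]"]) (simp add: map_poly_pCons laurent_const_def)

lemma generated_algebra_add:
  fixes f :: "'n laurent"
  assumes "F \<in> generated_algebra f" "G \<in> generated_algebra f"
  shows "F + G \<in> generated_algebra f"
proof -
  from assms obtain p q where "F = poly (map_poly laurent_const p) f" "G = poly (map_poly laurent_const q) f"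
    unfolding generated_algebra_def by blast
  moreover have "map_poly (laurent_const :: rat \<Rightarrow> 'n laurent) (p + q)
      = map_poly laurent_const p + map_poly laurent_const q"
    by (intro poly_eqI) (simp add: coeff_map_poly laurent_const_add)
  ultimately show ?thesis
    unfolding generated_algebra_def by (intro range_eqI[of _ _ "p + q"]) simp
qed

lemma generated_algebra_mult:
  fixes f :: "'n laurent"
  assumes "F \<in> generated_algebra f" "G \<in> generated_algebra f"
  shows "F * G \<in> generated_algebra f"
proof -
  from assms obtain p q where "F = poly (map_poly laurent_const p) f" "G = poly (map_poly laurent_const q) f"
    unfolding generated_algebra_def by blast
  moreover have "map_poly (laurent_const :: rat \<Rightarrow> 'n laurent) (p * q)
      = map_poly laurent_const p * map_poly laurent_const q"
    by (intro poly_eqI) (simp add: coeff_map_poly coeff_mult laurent_const_sum laurent_const_mult)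
  ultimately show ?thesis
    unfolding generated_algebra_def by (intro range_eqI[of _ _ "p * q"]) simp
qed

lemma generated_algebra_diff:
  assumes "F \<in> generated_algebra f" "G \<in> generated_algebra f"
  shows "F - G \<in> generated_algebra f"
proof -
  have "laurent_const (- 1) * G = - G"
    by (simp add: laurent_const_def single_uminus)
  with generated_algebra_add[OF assms(1) generated_algebra_mult[OF generated_algebra_const assms(2), of "- 1"]]
  show ?thesis by simp
qed

lemma generated_algebra_sum:
  "(\<And>a. a \<in> A \<Longrightarrow> F a \<in> generated_algebra f) \<Longrightarrow> sum F A \<in> generated_algebra f"
  using generated_algebra_const[of 0]
  by (induction A rule: infinite_finite_induct) (auto simp: generated_algebra_add)

lemma laurent_eval_poly:
  assumes "\<And>k. y k \<noteq> 0"
  shows "laurent_eval (poly (map_poly laurent_const p) f) y = poly (map_poly of_rat p) (laurent_eval f y)"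
  by (induction p) (simp_all add: map_poly_pCons laurent_eval_add laurent_eval_mult assms laurent_eval_lin_ext[of 0])

section \<open>The involution of one variable and invariance under the generated group\<close>

abbreviation (input) involution_sum :: "'n \<Rightarrow> nat \<Rightarrow> 'n laurent" where
  "involution_sum s z \<equiv>
    (laurent_const (of_nat z) + laurent_var s ^ 2) * laurent_monom (- Poly_Mapping.single s 1)"

lemma laurent_eval_involution_sum:
  assumes "\<And>k. y k \<noteq> 0"
  shows "laurent_eval (involution_sum s z) y = of_nat z / y s + y s"
proof -
  have "laurent_eval (involution_sum s z) y = (of_nat z + (y s)\<^sup>2) * y s powi (- 1)"
    by (simp add: laurent_eval_mult laurent_eval_add assms power2_eq_square laurent_var_def laurent_monom_def
        laurent_eval_lin_ext[of "Poly_Mapping.single _ _"] single_uminus[symmetric])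
  then show ?thesis
    using assms[of s] by (simp add: power_int_minus field_simps power2_eq_square)
qed

text \<open>Induction over the generation of the group. For an inverse, invariance under the
  generator \<open>h\<close> is applied at the preimage of the given point under
  \<open>h\<close>.\<close>

lemma generate_BijGroup_invariant:
  assumes H: "H \<subseteq> Bij S" and \<phi>: "\<And>h y. h \<in> H \<Longrightarrow> y \<in> S \<Longrightarrow> \<phi> (h y) = \<phi> y"
    and g: "g \<in> generate (BijGroup S) H" and y: "y \<in> S"
  shows "\<phi> (g y) = \<phi> y"
proof -
  interpret group "BijGroup S" by (rule group_BijGroup)
  have carrier: "carrier (BijGroup S) = Bij S" by (simp add: BijGroup_def)
  have mult: "(a \<otimes>\<^bsub>BijGroup S\<^esub> b) z = a (b z)" if "a \<in> Bij S" "b \<in> Bij S" "z \<in> S" for a b z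
    using that by (simp add: BijGroup_def compose_eq)
  have maps: "a z \<in> S" if "a \<in> Bij S" "z \<in> S" for a z
    using that Bij_imp_funcset by blast
  from g have "g \<in> Bij S \<and> (\<forall>y\<in>S. \<phi> (g y) = \<phi> y)"
  proof (induction rule: generate.induct)
    case one
    then show ?case using one_closed by (simp add: carrier) (simp add: BijGroup_def)
  next
    case (incl h)
    then show ?case using H \<phi> by auto
  next
    case (inv h)
    then have h: "h \<in> Bij S" using H by auto
    then have inv_h: "inv\<^bsub>BijGroup S\<^esub> h \<in> Bij S" using inv_closed by (simp add: carrier)
    have "h ((inv\<^bsub>BijGroup S\<^esub> h) z) = z" if "z \<in> S" for z
    proof -
      have "h ((inv\<^bsub>BijGroup S\<^esub> h) z) = (h \<otimes>\<^bsub>BijGroup S\<^esub> inv\<^bsub>BijGroup S\<^esub> h) z"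
        using mult[OF h inv_h that] by simp
      also have "\<dots> = z" using r_inv[of h] h that by (simp add: carrier) (simp add: BijGroup_def)
      finally show ?thesis .
    qed
    with \<phi>[OF inv maps[OF inv_h]] show ?case using inv_h by simp
  next
    case (eng h1 h2)
    then have h: "h1 \<in> Bij S" "h2 \<in> Bij S" by blast+
    then have "h1 \<otimes>\<^bsub>BijGroup S\<^esub> h2 \<in> Bij S" using m_closed by (simp add: carrier)
    moreover have "\<phi> ((h1 \<otimes>\<^bsub>BijGroup S\<^esub> h2) z) = \<phi> z" if "z \<in> S" for z
      using eng.IH that by (simp add: mult[OF h that] maps[OF h(2) that])
    ultimately show ?case by blast
  qed
  with y show ?thesis by blast
qed

lemma laurent_const_iff_keys: "(F :: 'n laurent) \<in> range laurent_const \<longleftrightarrow> (\<forall>m\<in>Poly_Mapping.keys F. m = 0)"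
proof
  assume "\<forall>m\<in>Poly_Mapping.keys F. m = 0"
  then have "F = laurent_const (Poly_Mapping.lookup F 0)"
    by (intro poly_mapping_eqI) (auto simp: laurent_const_def lookup_single when_def in_keys_iff)
  then show "F \<in> range laurent_const" by blast
qed (auto simp: laurent_const_def split: if_splits)

lemma of_rat_power_int: "of_rat (a powi n) = of_rat a powi n"
  by (simp add: power_int_def of_rat_power of_rat_inverse)

text \<open>The power \<open>e\<close> of variable \<open>s\<close> plus its image under the
  involution replacing the variable by \<open>z\<close> divided by it.\<close>

definition reciprocal_sum :: "'n \<Rightarrow> nat \<Rightarrow> int \<Rightarrow> 'n laurent" where
  "reciprocal_sum s z e = Poly_Mapping.single (Poly_Mapping.single s e) 1
    + Poly_Mapping.single (Poly_Mapping.single s (- e)) (of_nat z powi e)"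

lemma laurent_eval_reciprocal_sum:
  "laurent_eval (reciprocal_sum s z e) y = y s powi e + (of_nat z / y s) powi e"
  by (simp add: reciprocal_sum_def laurent_eval_lin_ext power_int_divide_distrib power_int_minus
      of_rat_power_int field_simps)

text \<open>The variable and its image have sum \<open>?f\<close> and product \<open>z\<close>, so
  their power sums satisfy the two-term recurrence of Newton. A negative exponent reduces to its
  opposite by the factor \<open>of_nat z powi e\<close>.\<close>

lemma reciprocal_sum_in_generated_algebra:
  fixes z :: nat and e :: int
  assumes z: "0 < z"
  shows "reciprocal_sum s z e \<in> generated_algebra (involution_sum s z :: 'n::finite laurent)"
proof -
  let ?f = "involution_sum s z :: 'n laurent"
  let ?c = "reciprocal_sum s z"
  note eval = laurent_eval_reciprocal_sum
  have nonneg: "?c (int n) \<in> generated_algebra ?f" for n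
  proof (induction n rule: induct_nat_012)
    case 0
    have "?c (int 0) = laurent_const 2"
      by (rule laurent_eqI_positive) (simp add: eval)
    then show ?case by (simp add: generated_algebra_const)
  next
    case 1
    have "?c (int (Suc 0)) = ?f"
      by (rule laurent_eqI_positive) (simp add: eval laurent_eval_involution_sum less_imp_neq[symmetric])
    then show ?case by (simp add: generated_algebra_generator)
  next
    case (ge2 n)
    have "?c (int (Suc (Suc n))) = ?f * ?c (int (Suc n)) - laurent_const (of_nat z) * ?c (int n)"
    proof (rule laurent_eqI_positive)
      fix y :: "'n \<Rightarrow> real" assume y: "\<And>k. 0 < y k"
      then have nz: "y k \<noteq> 0" for k by (simp add: less_imp_neq[symmetric])
      define w where "w = of_nat z / y s"
      have w: "of_nat z = w * y s" using y[of s] by (simp add: w_def)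
      have "laurent_eval (?f * ?c (int (Suc n)) - laurent_const (of_nat z) * ?c (int n)) y
          = (w + y s) * (y s ^ Suc n + w ^ Suc n) - of_nat z * (y s ^ n + w ^ n)"
        by (simp only: laurent_eval_diff laurent_eval_mult[OF nz, of ?f]
            laurent_eval_mult[OF nz, of "laurent_const _"] laurent_eval_involution_sum[OF nz]
            eval laurent_eval_const power_int_of_nat w_def of_rat_of_nat_eq)
      also have "\<dots> = y s ^ Suc (Suc n) + w ^ Suc (Suc n)"
        unfolding w by (simp add: algebra_simps)
      also have "\<dots> = laurent_eval (?c (int (Suc (Suc n)))) y"
        by (simp only: eval power_int_of_nat w_def)
      finally show "laurent_eval (?c (int (Suc (Suc n)))) y
          = laurent_eval (?f * ?c (int (Suc n)) - laurent_const (of_nat z) * ?c (int n)) y" by simp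
    qed
    then show ?case
      using ge2 by (simp only:) (intro generated_algebra_diff generated_algebra_mult
          generated_algebra_const generated_algebra_generator)
  qed
  show ?thesis
  proof (cases "0 \<le> e")
    case True
    then show ?thesis using nonneg[of "nat e"] by simp
  next
    case False
    have "?c e = laurent_const (of_nat z powi e) * ?c (- e)"
    proof (rule laurent_eqI_positive)
      fix y :: "'n \<Rightarrow> real" assume y: "\<And>k. 0 < y k"
      then have nz: "y k \<noteq> 0" for k by (simp add: less_imp_neq[symmetric])
      show "laurent_eval (?c e) y = laurent_eval (laurent_const (of_nat z powi e) * ?c (- e)) y"
        using nz z
        by (simp add: laurent_eval_mult eval of_rat_power_int power_int_divide_distrib
            power_int_minus field_simps)
    qed
    with nonneg[of "nat (- e)"] False show ?thesis
      by (simp add: generated_algebra_mult generated_algebra_const)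
  qed
qed

section \<open>Invariants under all mutations\<close>

context
  fixes \<Omega> :: "('n::finite, 'k::field_char_0) seed" and G
  assumes seed: "is_seed \<Omega>"
  defines "G \<equiv> generated_group \<Omega> {(id, i) | i. True}"
begin

text \<open>For identity permutations both maxima in the bound collapse to single matrix entries,
  contradicting the largeness of the product unless the width is zero.\<close>

lemma invariant_width_large:
  assumes "F \<noteq> 0" "F \<in> invariants \<Omega> G" "i \<in> large_indices \<Omega>"
  shows "width F i = 0"
proof (rule ccontr)
  assume "width F i \<noteq> 0"
  with width_nonneg[OF assms(1), of i] have pos: "0 < width F i" by simp
  obtain j where "j \<noteq> i" and
    large: "int (mdeg \<Omega> i) * int (mdeg \<Omega> j) * \<bar>exmat \<Omega> i j * exmat \<Omega> j i\<bar> > 4"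
    using assms(3) unfolding large_indices_def by blast
  have "int (mdeg \<Omega> i) * int (mdeg \<Omega> j) * \<bar>exmat \<Omega> j i\<bar> * \<bar>exmat \<Omega> i j\<bar> \<le> 4"
    using invariant_bound[OF seed, of id i "{(id, i) | i. True}" id j F] assms(1,2) pos
    by (simp add: G_def)
  with large show False by (simp add: abs_mult mult_ac)
qed

text \<open>The range of exponents is symmetric about zero, so width zero confines it to
  zero.\<close>

lemma invariant_lookup_0:
  assumes F: "F \<noteq> 0" "F \<in> invariants \<Omega> G" and "width F i = 0" and m: "m \<in> Poly_Mapping.keys F"
  shows "Poly_Mapping.lookup m i = 0"
proof -
  interpret seed_exchange \<Omega> i by standard (rule seed)
  have "top_exp F i = pole_order F i"
    by (rule invariant_top_exp_self[of F "{(id, i) | i. True}" id]) (use F in \<open>auto simp: G_def\<close>)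
  with assms(3) top_exp_ge[OF m, of i] pole_order_ge[OF m, of i] show ?thesis
    by (simp add: width_def)
qed

lemma invariant_const:
  assumes F: "F \<in> invariants \<Omega> G" and "F \<noteq> 0 \<Longrightarrow> \<forall>i. width F i = 0"
  shows "F \<in> range laurent_const"
proof (cases "F = 0")
  case False
  with assms invariant_lookup_0[OF False F] show ?thesis
    unfolding laurent_const_iff_keys by (auto intro!: poly_mapping_eqI)
qed (simp add: laurent_const_iff_keys)

text \<open>Only variable \<open>s\<close> occurs in \<open>F\<close>. Averaging \<open>F\<close>
  with its image under the mutation turns each monomial into half of a
  \<open>reciprocal_sum\<close>.\<close>

lemma invariant_isolated_in_generated_algebra:
  assumes F: "F \<noteq> 0" "F \<in> invariants \<Omega> G" and width: "\<And>i. i \<noteq> s \<Longrightarrow> width F i = 0"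
    and isolated: "\<forall>k. exmat \<Omega> k s = 0"
  shows "F \<in> generated_algebra (involution_sum s (poly (expol \<Omega> s) 1))"
proof -
  interpret seed_exchange \<Omega> s by standard (rule seed)
  define z where "z = poly (expol \<Omega> s) 1"
  have z: "0 < z"
    \<comment> \<open>For an isolated index the exchange polynomial is the constant
      \<open>z\<close>, and it is positive at the all-ones point.\<close>
    using val_positive[of "\<lambda>_. 1"] val_isolated[OF isolated, of "\<lambda>_. 1 :: real"] by (simp add: z_def)
  let ?c = "reciprocal_sum s z"
  have char: "laurent_char y m = y s powi Poly_Mapping.lookup m s"
    if "m \<in> Poly_Mapping.keys F" for y :: "'n \<Rightarrow> real" and m
  proof -
    have "m = Poly_Mapping.single s (Poly_Mapping.lookup m s)"
      using invariant_lookup_0[OF F width that]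
      by (intro poly_mapping_eqI) (auto simp: lookup_single when_def)
    then show ?thesis by (metis laurent_char_single)
  qed
  let ?S = "laurent_const (1 / 2) * (\<Sum>m\<in>Poly_Mapping.keys F.
      laurent_const (Poly_Mapping.lookup F m) * ?c (Poly_Mapping.lookup m s))"
  have "F = ?S"
  proof (rule laurent_eqI_positive)
    fix y :: "'n \<Rightarrow> real" assume y: "\<And>k. 0 < y k"
    then have nz: "y k \<noteq> 0" for k by (simp add: less_imp_neq[symmetric])
    have "laurent_eval F (mut y) = laurent_eval F y"
      using invariant_positive_reals[of F "{(id, i) | i. True}" id y] F y by (simp add: G_def)
    then have "2 * laurent_eval F y = laurent_eval F y + laurent_eval F (mut y)" by simp
    also have "\<dots> = (\<Sum>m\<in>Poly_Mapping.keys F. of_rat (Poly_Mapping.lookup F m) *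
        (y s powi Poly_Mapping.lookup m s + (of_nat z / y s) powi Poly_Mapping.lookup m s))"
      by (simp add: laurent_eval_lin_ext lin_ext_def char mut_def val_isolated[OF isolated] z_def
          sum.distrib[symmetric] distrib_left)
    also have "\<dots> = 2 * laurent_eval ?S y"
      using nz by (simp add: laurent_eval_mult laurent_eval_reciprocal_sum laurent_eval_lin_ext[of "sum _ _"]
          laurent_eval_lin_ext[symmetric] of_rat_divide)
    finally show "laurent_eval F y = laurent_eval ?S y" by simp
  qed
  also have "?S \<in> generated_algebra (involution_sum s z)"
    by (intro generated_algebra_mult generated_algebra_const generated_algebra_sum
        reciprocal_sum_in_generated_algebra z)
  finally show ?thesis by (simp add: z_def)
qed

text \<open>Mutation at \<open>s\<close> swaps the two summands of \<phi>, and any other mutation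
  fixes variable \<open>s\<close>. Invariance thus holds for the generators, extends to the group,
  and passes to polynomials in the generator of the algebra.\<close>

lemma generated_algebra_invariant:
  assumes isolated: "\<forall>k. exmat \<Omega> k s = 0"
  shows "generated_algebra (involution_sum s (poly (expol \<Omega> s) 1)) \<subseteq> invariants \<Omega> G"
proof
  fix F assume "F \<in> generated_algebra (involution_sum s (poly (expol \<Omega> s) 1))"
  then obtain p where F: "F = poly (map_poly laurent_const p) (involution_sum s (poly (expol \<Omega> s) 1))"
    unfolding generated_algebra_def by blast
  let ?z = "of_nat (poly (expol \<Omega> s) 1) :: 'k"
  define \<phi> :: "('n \<Rightarrow> 'k) \<Rightarrow> 'k" where "\<phi> y = ?z / y s + y s" for y
  let ?H = "cluster_map \<Omega> ` {(id, i) | i. True}"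
  have bij: "h \<in> Bij clusters" if "h \<in> ?H" for h
    using that seed_exchange.cluster_map_Bij[OF seed_exchange.intro[OF seed]] by auto
  have step: "\<phi> (h y) = \<phi> y" if h: "h \<in> ?H" and y: "y \<in> clusters" for h y
  proof -
    obtain i where i: "h = cluster_map \<Omega> (id, i)" using h by auto
    interpret seed_exchange \<Omega> i by standard (rule seed)
    have "y s \<noteq> 0" "val y \<noteq> 0"
      using y by (auto simp: clusters_def free_generators_nonzero val_nonzero)
    then show ?thesis
      using val_isolated[of y] isolated by (auto simp: i cluster_map_eq[OF y] \<phi>_def mut_def)
  qed
  show "F \<in> invariants \<Omega> G"
    unfolding invariants_def
  proof (intro CollectI ballI)
    fix g assume g: "g \<in> G"
    have x: "clust \<Omega> \<in> clusters" using seed by (simp add: is_seed_def clusters_def)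
    have g': "g \<in> generate (BijGroup clusters) ?H"
      using g by (simp add: G_def generated_group_def)
    interpret group "BijGroup (clusters :: ('n \<Rightarrow> 'k) set)" by (rule group_BijGroup)
    have "g \<in> Bij clusters"
      using generate_in_carrier[of ?H g] g' bij by (auto simp: BijGroup_def)
    \<comment> \<open>Being a cluster, the image has nonzero coordinates, so evaluation there is a
      ring homomorphism.\<close>
    then have gx: "g (clust \<Omega>) \<in> clusters"
      using x Bij_imp_funcset by blast
    have "\<phi> (g (clust \<Omega>)) = \<phi> (clust \<Omega>)"
      by (rule generate_BijGroup_invariant[OF _ step g' x]) (use bij in auto)
    then show "laurent_eval F (g (clust \<Omega>)) = laurent_eval F (clust \<Omega>)"
      using x gx unfolding F
      by (simp add: laurent_eval_poly laurent_eval_involution_sum clusters_def free_generators_nonzero \<phi>_def)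
  qed
qed

end

section \<open>Both parts of the theorem\<close>

theorem theorem3p28:
  fixes \<Omega> :: "('n::finite, 'k::field_char_0) seed"
    and B :: "'n \<Rightarrow> 'n \<Rightarrow> int" and r :: "'n \<Rightarrow> nat"
  assumes seed: "is_seed \<Omega>"
    and B: "B = exmat \<Omega>" and r: "r = mdeg \<Omega>"
  shows
    "(\<forall>\<sigma> \<tau> i j F \<eta> d.
        (\<sigma>, i) \<in> sym_mutations \<Omega> \<longrightarrow> (\<tau>, j) \<in> sym_mutations \<Omega> \<longrightarrow> i \<noteq> j \<longrightarrow>
        F \<in> invariants \<Omega> (generated_group \<Omega> {(\<sigma>, i), (\<tau>, j)}) \<longrightarrow>
        has_type F \<eta> d \<longrightarrow> \<eta> i \<noteq> 0 \<longrightarrow>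
        4 \<ge> int (r i) * int (r j) * Max {\<bar>B j i\<bar>, \<bar>B (\<sigma> j) i\<bar>} *
          Max {\<bar>B i j\<bar>, \<bar>B (\<tau> i) j\<bar>, \<bar>B (inv_into UNIV \<sigma> i) j\<bar>, \<bar>B (\<tau> (inv_into UNIV \<sigma> i)) j\<bar>})
     \<and>
     ((\<forall>i. (id, i) \<in> sym_mutations \<Omega>) \<longrightarrow>
        (card (large_indices \<Omega>) = CARD('n) \<longrightarrow>
           invariants \<Omega> (generated_group \<Omega> {(id, i) | i. True}) = range laurent_const)
        \<and>
        (card (large_indices \<Omega>) = CARD('n) - 1 \<longrightarrow>
           (\<forall>s. UNIV - large_indices \<Omega> = {s} \<longrightarrow>
              invariants \<Omega> (generated_group \<Omega> {(id, i) | i. True}) =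
                (if \<forall>k. B k s = 0
                 then generated_algebra
                   ((laurent_const (of_nat (poly (expol \<Omega> s) 1)) + laurent_var s ^ 2)
                      * laurent_monom (- Poly_Mapping.single s 1))
                 else range laurent_const))))"
    (is "?bound \<and> (_ \<longrightarrow> (_ \<longrightarrow> ?I = _) \<and> _)")
proof -
  have const: "range laurent_const \<subseteq> ?I"
    using laurent_const_in_invariants by blast
  have bound: ?bound
  proof (intro allI impI)
    fix \<sigma> \<tau> i j F \<eta> d
    assume "(\<sigma>, i) \<in> sym_mutations \<Omega>" "(\<tau>, j) \<in> sym_mutations \<Omega>"
      and F: "F \<in> invariants \<Omega> (generated_group \<Omega> {(\<sigma>, i), (\<tau>, j)})"
        "has_type F \<eta> d" "\<eta> i \<noteq> 0"
    then have "bij \<sigma>" "bij \<tau>" by (auto simp: sym_mutations_def)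
    moreover have "F \<noteq> 0" "0 < width F i"
      using has_type_width(1)[OF F(2)] has_type_width(2)[OF F(2), of i] F(3) by auto
    ultimately show "4 \<ge> int (r i) * int (r j) * Max {\<bar>B j i\<bar>, \<bar>B (\<sigma> j) i\<bar>} *
          Max {\<bar>B i j\<bar>, \<bar>B (\<tau> i) j\<bar>, \<bar>B (inv_into UNIV \<sigma> i) j\<bar>, \<bar>B (\<tau> (inv_into UNIV \<sigma> i)) j\<bar>}"
      unfolding B r using F(1) by (intro invariant_bound[OF seed]) auto
  qed
  have all: "?I = range laurent_const" if "card (large_indices \<Omega>) = CARD('n)"
  proof
    have "large_indices \<Omega> = UNIV"
      using that by (intro card_subset_eq) auto
    then show "?I \<subseteq> range laurent_const"
      using invariant_const[OF seed] invariant_width_large[OF seed] by blast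
  qed (rule const)
  have single: "?I = (if \<forall>k. B k s = 0
      then generated_algebra (involution_sum s (poly (expol \<Omega> s) 1)) else range laurent_const)"
    if s: "UNIV - large_indices \<Omega> = {s}" for s
  proof -
    have width: "width F i = 0" if "F \<in> ?I" "F \<noteq> 0" "i \<noteq> s" for F i
      using invariant_width_large[OF seed that(2,1), of i] s that(3) by blast
    show ?thesis
    proof (cases "\<forall>k. B k s = 0")
      case True
      have "F \<in> generated_algebra (involution_sum s (poly (expol \<Omega> s) 1))" if "F \<in> ?I" for F
      \<comment> \<open>Zero is treated apart, since \<open>width\<close> carries information for
        nonzero \<open>F\<close> only.\<close>
      proof (cases "F = 0")
        case True
        then show ?thesis using generated_algebra_const[of 0] by simp
      next
        case False
        then show ?thesis
          using invariant_isolated_in_generated_algebra[OF seed False that, of s] width[OF that False]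
            \<open>\<forall>k. B k s = 0\<close> by (simp add: B)
      qed
      moreover have "generated_algebra (involution_sum s (poly (expol \<Omega> s) 1)) \<subseteq> ?I"
        using generated_algebra_invariant[OF seed] True by (simp add: B)
      ultimately show ?thesis using True by auto
    next
      case False
      then obtain k where k: "exmat \<Omega> k s \<noteq> 0" by (auto simp: B)
      interpret seed_exchange \<Omega> s by standard (rule seed)
      have "k \<noteq> s" using k b_self by auto
      have "width F s = 0" if F: "F \<in> ?I" "F \<noteq> 0" for F
      proof -
        \<comment> \<open>The row index \<open>k\<close> of a nonzero entry in column
          \<open>s\<close> is large and so has width zero, which forces width zero at
          \<open>s\<close> too.\<close>
        have "int (mdeg \<Omega> s) * \<bar>exmat \<Omega> k s\<bar> * width F s \<le> 2 * width F k"
          by (rule invariant_width_ge[OF F(2,1)]) auto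
        also have "width F k = 0" by (rule width[OF F \<open>k \<noteq> s\<close>])
        finally have "int (mdeg \<Omega> s) * \<bar>exmat \<Omega> k s\<bar> * width F s \<le> 0" by simp
        then show ?thesis
          using width_nonneg[OF F(2), of s] k mdeg_pos by (auto simp: mult_le_0_iff)
      qed
      with width have "\<forall>i. width F i = 0" if "F \<in> ?I" "F \<noteq> 0" for F
        using that by metis
      then have "?I \<subseteq> range laurent_const"
        using invariant_const[OF seed] by blast
      with const False show ?thesis by auto
    qed
  qed
  show ?thesis
    using bound all single by blast
qed

end
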